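(* Let $c$ be a real number and let $m=m(n)$ be a sequence of positive integers with $m(n)\to+\infty$ as $n\to+\infty$. Let $(X,Q),(X_1,Q_1),(X_2,Q_2),\dots$ be independent and identically distributed bivariate random variables with values in $\{0,1,2,\dots\}\times[0,1]$. Assume that $$\mathbf{E}\bigl(Xh(X,Q)\ln(X+1)\bigr)<\infty\qquad\text{and}\qquad \mathbf{E}\bigl(Q\,\mathbb{I}_{\{X\ge 2\}}\bigr)>0 .$$ Let $G_{[n,m]}$ be the random graph on the vertex set $[n]$ defined by the sequence $(X_{n,i},Q_{n,i})$, $1\le i\le m$, with $X_{n,i}=\min\{X_i,n\}$ and $Q_{n,i}=Q_i$. Put $\varkappa=\mathbf{E}(Xh(X,Q))$ and $\lambda_{m,n}=\ln n-\varkappa\frac{m}{n}$. Then $$\lim_{n\to+\infty}\mathbf{P}\{G_{[n,m]}\text{ is connected}\}=\begin{cases}1, & \text{if }\lambda_{m,n}\to-\infty,\\ e^{-e^{c}}, & \text{if }\lambda_{m,n}\to c,\\ 0, & \text{if }\lambda_{m,n}\to+\infty,\end{cases}$$ where the convergence of $\lambda_{m,n}$ is as $n\to+\infty$.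
   Context: Notation: $[n]=\{1,\dots,n\}$, $(x)_+=\max\{x,0\}$, $\mathbb{I}_{\mathcal A}$ is the indicator of the event $\mathcal A$. For $(x,q)\in[0,+\infty)\times[0,1]$, $h(x,q)=1-(1-q)^{(x-1)_+}$, with the convention $0^0=1$. Random graph $G_{[n,m]}$: given independent bivariate random variables $(X_{n,1},Q_{n,1}),\dots,(X_{n,m},Q_{n,m})$ with values in $\{0,1,\dots,n\}\times[0,1]$, define independent random graphs $G_{n,i}=(\mathcal V_{n,i},\mathcal E_{n,i})$, $1\le i\le m$, as follows. First sample $(X_{n,i},Q_{n,i})$. Then, given $(X_{n,i},Q_{n,i})$, select $\mathcal V_{n,i}\subset[n]$ uniformly at random among all subsets of size $X_{n,i}$, and link every pair of elements of $\mathcal V_{n,i}$ by an edge independently at random with probability $Q_{n,i}$. The graph $G_{[n,m]}$ has vertex set $[n]$ and edge set $\bigcup_{i=1}^m\mathcal E_{n,i}$; it is said to be defined by the sequence $(X_{n,1},Q_{n,1}),\dots,(X_{n,m},Q_{n,m})$. *)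

theory Defs
  imports "HOL-Probability.Probability"
begin

type_synonym ugraph = "nat set \<times> nat set set"

definition pairs :: "nat set \<Rightarrow> nat set set" where
  "pairs V = {e. e \<subseteq> V \<and> card e = 2}"

definition connected_graph :: "ugraph \<Rightarrow> bool" where
  "connected_graph G \<longleftrightarrow>
     fst G \<noteq> {} \<and> (\<forall>u\<in>fst G. \<forall>v\<in>fst G. (u, v) \<in> {(a, b). {a, b} \<in> snd G}\<^sup>*)"

text \<open>
  The first argument is only ever integer valued, so truncated subtraction is the positive
  part of \<open>x - 1\<close>, and \<open>0 ^ 0 = 1\<close> holds by definition of the power function.
\<close>

definition h :: "nat \<Rightarrow> real \<Rightarrow> real" where
  "h x q = 1 - (1 - q) ^ (x - 1)"

definition random_edges_pmf :: "nat set \<Rightarrow> real \<Rightarrow> nat set set pmf" where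
  "random_edges_pmf V q =
     map_pmf (\<lambda>b. {e \<in> pairs V. b e}) (Pi_pmf (pairs V) False (\<lambda>_. bernoulli_pmf q))"

text \<open>
  The conditional law of one of the graphs \<open>(V\<^sub>i, E\<^sub>i)\<close> given that its size variable equals \<open>x\<close>
  and its density variable equals \<open>q\<close>. It is meaningful for \<open>x \<le> n\<close> and \<open>0 \<le> q \<le> 1\<close>.
\<close>

definition community_pmf :: "nat \<Rightarrow> nat \<Rightarrow> real \<Rightarrow> ugraph pmf" where
  "community_pmf n x q = do {
     V \<leftarrow> pmf_of_set {V. V \<subseteq> {1..n} \<and> card V = x};
     E \<leftarrow> random_edges_pmf V q;
     return_pmf (V, E)
   }"

text \<open>
  The conditional law of the union graph given the values \<open>(x i, q i)\<close>, \<open>1 \<le> i \<le> m\<close>: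
  the graphs are drawn independently of each other and their edge sets are united.
\<close>

definition union_graph_pmf :: "nat \<Rightarrow> nat \<Rightarrow> (nat \<Rightarrow> nat) \<Rightarrow> (nat \<Rightarrow> real) \<Rightarrow> ugraph pmf" where
  "union_graph_pmf n m x q =
     map_pmf (\<lambda>G. ({1..n}, \<Union>i\<in>{1..m}. snd (G i)))
       (Pi_pmf {1..m} ({}, {}) (\<lambda>i. community_pmf n (x i) (q i)))"

text \<open>
  The law of the graph on \<open>{1..n}\<close> defined by the sequence \<open>(X i, Q i)\<close>, \<open>1 \<le> i \<le> m\<close>, of random
  variables on \<open>M\<close>: first the sequence is sampled, then the graph from its conditional law.
  Since the graphs are conditionally independent given the sequence, and the conditional law
  of the \<open>i\<close>-th graph depends on \<open>(X i, Q i)\<close> only, they are independent whenever the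
  pairs \<open>(X i, Q i)\<close> are.
\<close>

definition random_graph ::
    "'a measure \<Rightarrow> nat \<Rightarrow> nat \<Rightarrow> (nat \<Rightarrow> 'a \<Rightarrow> nat) \<Rightarrow> (nat \<Rightarrow> 'a \<Rightarrow> real) \<Rightarrow> ugraph measure" where
  "random_graph M n m X Q =
     M \<bind> (\<lambda>\<omega>. measure_pmf (union_graph_pmf n m (\<lambda>i. X i \<omega>) (\<lambda>i. Q i \<omega>)))"

lemma finite_pairs: "finite V \<Longrightarrow> finite (pairs V)"
  unfolding pairs_def by (rule finite_subset[of _ "Pow V"]) auto

lemma pmf_map_finite:
  assumes "finite S" "set_pmf p \<subseteq> S"
  shows "pmf (map_pmf f p) y = (\<Sum>x\<in>S. if f x = y then pmf p x else 0)"
proof -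
  have "pmf (map_pmf f p) y = measure_pmf.prob p (f -` {y})"
    by (simp add: pmf_map)
  also have "\<dots> = measure_pmf.prob p (f -` {y} \<inter> S)"
    using assms(2) by (intro measure_eq_AE) (auto simp: AE_measure_pmf_iff)
  also have "\<dots> = (\<Sum>x\<in>f -` {y} \<inter> S. pmf p x)"
    using assms(1) by (intro measure_measure_pmf_finite) auto
  also have "\<dots> = (\<Sum>x\<in>S. if f x = y then pmf p x else 0)"
    using assms(1) by (intro sum.mono_neutral_cong_left) auto
  finally show ?thesis .
qed

lemma measurable_pmf_map:
  assumes "finite S" "\<And>\<omega>. \<omega> \<in> space M \<Longrightarrow> set_pmf (p \<omega>) \<subseteq> S"
    and "\<And>x. (\<lambda>\<omega>. pmf (p \<omega>) x) \<in> borel_measurable M"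
  shows "(\<lambda>\<omega>. pmf (map_pmf f (p \<omega>)) y) \<in> borel_measurable M"
proof -
  have "(\<lambda>\<omega>. \<Sum>x\<in>S. if f x = y then pmf (p \<omega>) x else 0) \<in> borel_measurable M"
    using assms(3) by (intro borel_measurable_sum) auto
  then show ?thesis
    by (rule measurable_cong[THEN iffD1, rotated]) (use assms in \<open>simp add: pmf_map_finite\<close>)
qed

lemma measurable_pmf_Pi:
  assumes "finite A" "\<And>i x. i \<in> A \<Longrightarrow> (\<lambda>\<omega>. pmf (p i \<omega>) x) \<in> borel_measurable M"
  shows "(\<lambda>\<omega>. pmf (Pi_pmf A d (\<lambda>i. p i \<omega>)) f) \<in> borel_measurable M"
  using assms by (subst pmf_Pi) (auto intro!: borel_measurable_prod)

lemma measurable_pmf_bernoulli: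
  assumes "Q \<in> borel_measurable M" "\<And>\<omega>. \<omega> \<in> space M \<Longrightarrow> Q \<omega> \<in> {0..1}"
  shows "(\<lambda>\<omega>. pmf (bernoulli_pmf (Q \<omega>)) b) \<in> borel_measurable M"
proof -
  have "(\<lambda>\<omega>. if b then Q \<omega> else 1 - Q \<omega>) \<in> borel_measurable M"
    using assms(1) by (cases b) auto
  then show ?thesis
    by (rule measurable_cong[THEN iffD1, rotated]) (use assms(2) in \<open>cases b; auto\<close>)
qed

lemma measurable_pmf_random_edges:
  assumes "finite V" "Q \<in> borel_measurable M" "\<And>\<omega>. \<omega> \<in> space M \<Longrightarrow> Q \<omega> \<in> {0..1}"
  shows "(\<lambda>\<omega>. pmf (random_edges_pmf V (Q \<omega>)) E) \<in> borel_measurable M"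
  unfolding random_edges_pmf_def
proof (rule measurable_pmf_map)
  show "finite (PiE_dflt (pairs V) False (\<lambda>_. UNIV :: bool set))"
    using assms(1) by (intro finite_PiE_dflt finite_pairs) auto
  show "set_pmf (Pi_pmf (pairs V) False (\<lambda>_. bernoulli_pmf (Q \<omega>)))
          \<subseteq> PiE_dflt (pairs V) False (\<lambda>_. UNIV)" for \<omega>
    using set_Pi_pmf_subset'[OF finite_pairs[OF assms(1)], of False "\<lambda>_. bernoulli_pmf (Q \<omega>)"]
    by (auto simp: PiE_dflt_def)
  show "(\<lambda>\<omega>. pmf (Pi_pmf (pairs V) False (\<lambda>_. bernoulli_pmf (Q \<omega>))) b) \<in> borel_measurable M" for b
    using assms by (intro measurable_pmf_Pi finite_pairs measurable_pmf_bernoulli) auto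
qed

lemma set_random_edges: "set_pmf (random_edges_pmf V q) \<subseteq> Pow (pairs V)"
  by (auto simp: random_edges_pmf_def)

lemma subsets_of_card:
  assumes "x \<le> n"
  shows "{V. V \<subseteq> {1..n} \<and> card V = x} \<noteq> {}" "finite {V. V \<subseteq> {1..n::nat} \<and> card V = x}"
proof -
  show "finite {V. V \<subseteq> {1..n} \<and> card V = x}"
    by (rule finite_subset[of _ "Pow {1..n}"]) auto
  show "{V. V \<subseteq> {1..n} \<and> card V = x} \<noteq> {}"
  proof -
    have "{1..x} \<in> {V. V \<subseteq> {1..n} \<and> card V = x}"
      using assms by simp
    then show ?thesis by blast
  qed
qed

lemma set_community:
  assumes "x \<le> n"
  shows "set_pmf (community_pmf n x q) \<subseteq> Pow {1..n} \<times> Pow (pairs {1..n})"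
proof
  fix G assume "G \<in> set_pmf (community_pmf n x q)"
  then obtain V E where G: "G = (V, E)"
    and V: "V \<in> set_pmf (pmf_of_set {V. V \<subseteq> {1..n} \<and> card V = x})"
    and E: "E \<in> set_pmf (random_edges_pmf V q)"
    by (auto simp: community_pmf_def)
  from V have "V \<subseteq> {1..n}"
    using subsets_of_card[OF assms] by (simp add: set_pmf_of_set)
  moreover have "E \<subseteq> pairs V"
    using E set_random_edges by blast
  ultimately show "G \<in> Pow {1..n} \<times> Pow (pairs {1..n})"
    unfolding G pairs_def by blast
qed

lemma measurable_pmf_community:
  assumes X: "X \<in> measurable M (count_space UNIV)" "\<And>\<omega>. \<omega> \<in> space M \<Longrightarrow> X \<omega> \<le> n"
    and Q: "Q \<in> borel_measurable M" "\<And>\<omega>. \<omega> \<in> space M \<Longrightarrow> Q \<omega> \<in> {0..1}"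
  shows "(\<lambda>\<omega>. pmf (community_pmf n (X \<omega>) (Q \<omega>)) G) \<in> borel_measurable M"
proof -
  let ?S = "\<lambda>x. {V. V \<subseteq> {1..n} \<and> card V = x}"
  let ?k = "\<lambda>V q. map_pmf (\<lambda>E. (V, E)) (random_edges_pmf V q)"
  have eq: "pmf (community_pmf n (X \<omega>) (Q \<omega>)) G
          = (\<Sum>V\<in>Pow {1..n}. pmf (pmf_of_set (?S (X \<omega>))) V * pmf (?k V (Q \<omega>)) G)"
    if "\<omega> \<in> space M" for \<omega>
  proof -
    note S = subsets_of_card[OF X(2)[OF that]]
    have "pmf (community_pmf n (X \<omega>) (Q \<omega>)) G
        = measure_pmf.expectation (pmf_of_set (?S (X \<omega>))) (\<lambda>V. pmf (?k V (Q \<omega>)) G)"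
      by (simp add: community_pmf_def pmf_bind map_pmf_def)
    also have "\<dots> = (\<Sum>V\<in>Pow {1..n}. pmf (pmf_of_set (?S (X \<omega>))) V * pmf (?k V (Q \<omega>)) G)"
      using S by (subst integral_measure_pmf[where A = "Pow {1..n}"]) auto
    finally show ?thesis .
  qed
  have "(\<lambda>\<omega>. \<Sum>V\<in>Pow {1..n}. pmf (pmf_of_set (?S (X \<omega>))) V * pmf (?k V (Q \<omega>)) G)
          \<in> borel_measurable M"
  proof (intro borel_measurable_sum borel_measurable_times)
    fix V assume V: "V \<in> Pow {1..n}"
    then have fV: "finite V" using finite_subset by auto
    show "(\<lambda>\<omega>. pmf (pmf_of_set (?S (X \<omega>))) V) \<in> borel_measurable M"
      by (rule measurable_compose[OF X(1)]) simp
    show "(\<lambda>\<omega>. pmf (?k V (Q \<omega>)) G) \<in> borel_measurable M"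
      using fV Q set_random_edges
      by (intro measurable_pmf_map[where S = "Pow (pairs V)"] measurable_pmf_random_edges)
         (auto simp: finite_pairs)
  qed
  then show ?thesis
    by (rule measurable_cong[THEN iffD1, rotated]) (simp add: eq)
qed

lemma measurable_union_graph_pmf:
  assumes X: "\<And>i. X i \<in> measurable M (count_space UNIV)" "\<And>i \<omega>. \<omega> \<in> space M \<Longrightarrow> X i \<omega> \<le> n"
    and Q: "\<And>i. Q i \<in> borel_measurable M" "\<And>i \<omega>. \<omega> \<in> space M \<Longrightarrow> Q i \<omega> \<in> {0..1}"
  shows "(\<lambda>\<omega>. measure_pmf (union_graph_pmf n m (\<lambda>i. X i \<omega>) (\<lambda>i. Q i \<omega>)))
           \<in> measurable M (subprob_algebra (count_space UNIV))"
proof (rule measurable_subprob_algebra)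
  let ?p = "\<lambda>\<omega>. Pi_pmf {1..m} ({}, {}) (\<lambda>i. community_pmf n (X i \<omega>) (Q i \<omega>))"
  let ?f = "\<lambda>G :: nat \<Rightarrow> ugraph. ({1..n}, \<Union>i\<in>{1..m}. snd (G i))"
  let ?S = "PiE_dflt {1..m} ({}, {}) (\<lambda>_. Pow {1..n} \<times> Pow (pairs {1..n}))"
  have fin: "finite ?S"
    by (intro finite_PiE_dflt) (auto simp: finite_pairs)
  have sub: "set_pmf (?p \<omega>) \<subseteq> ?S" if "\<omega> \<in> space M" for \<omega>
    using set_Pi_pmf_subset'[of "{1..m}" "({}, {})" "\<lambda>i. community_pmf n (X i \<omega>) (Q i \<omega>)"]
      set_community[OF X(2)[OF that]]
    unfolding PiE_dflt_def by fastforce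
  fix A :: "ugraph set"
  have "emeasure (measure_pmf (union_graph_pmf n m (\<lambda>i. X i \<omega>) (\<lambda>i. Q i \<omega>))) A
      = ennreal (pmf (map_pmf (\<lambda>G. ?f G \<in> A) (?p \<omega>)) True)" for \<omega>
    by (simp add: union_graph_pmf_def pmf_map measure_pmf.emeasure_eq_measure vimage_def)
  moreover have "(\<lambda>\<omega>. pmf (map_pmf (\<lambda>G. ?f G \<in> A) (?p \<omega>)) True) \<in> borel_measurable M"
    using fin sub X Q
    by (intro measurable_pmf_map[where S = ?S] measurable_pmf_Pi measurable_pmf_community) auto
  ultimately show "(\<lambda>\<omega>. emeasure (measure_pmf (union_graph_pmf n m (\<lambda>i. X i \<omega>) (\<lambda>i. Q i \<omega>))) A)
      \<in> borel_measurable M"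
    by simp
qed (auto simp: measure_pmf.subprob_space_axioms)

lemma (in prob_space)
  assumes "\<And>i. X i \<in> measurable M (count_space UNIV)" "\<And>i \<omega>. \<omega> \<in> space M \<Longrightarrow> X i \<omega> \<le> n"
    and "\<And>i. Q i \<in> borel_measurable M" "\<And>i \<omega>. \<omega> \<in> space M \<Longrightarrow> Q i \<omega> \<in> {0..1}"
  shows prob_space_random_graph: "prob_space (random_graph M n m X Q)"
    and measure_random_graph: "measure (random_graph M n m X Q) A =
      expectation (\<lambda>\<omega>. measure_pmf.prob (union_graph_pmf n m (\<lambda>i. X i \<omega>) (\<lambda>i. Q i \<omega>)) A)"
proof -
  have K: "(\<lambda>\<omega>. measure_pmf (union_graph_pmf n m (\<lambda>i. X i \<omega>) (\<lambda>i. Q i \<omega>)))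
           \<in> measurable M (subprob_algebra (count_space UNIV))"
    using assms by (rule measurable_union_graph_pmf)
  show "prob_space (random_graph M n m X Q)"
    unfolding random_graph_def
    by (rule prob_space_bind[OF _ K]) (rule AE_I2, rule measure_pmf.prob_space_axioms)
  show "measure (random_graph M n m X Q) A =
      expectation (\<lambda>\<omega>. measure_pmf.prob (union_graph_pmf n m (\<lambda>i. X i \<omega>) (\<lambda>i. Q i \<omega>)) A)"
    unfolding random_graph_def by (rule measure_bind[OF K]) simp
qed

end

(*
  The pairs (X i, Q i) being independent and identically distributed, the union graph is a union
  of m independent copies of one mixed random edge set D, and everything follows from three
  estimates for D. A given vertex is not isolated with probability at most kappa / n, two given
  vertices are both not isolated with probability at most e n / n, and no edge leaves a given set
  of k <= n / 2 vertices with probability at most 1 - (k / n) (kappa - e (n / k)), where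
  e s = E (X h min (1, X / s)). The logarithmic moment condition gives e s * ln s --> 0 by dominated
  convergence.

  The r-th binomial moment of the number of isolated vertices is then exp (r lambda + o(1)) / r!.
  The Bonferroni inequalities and the second moment method yield the limit of the probability that
  there is no isolated vertex. A disconnected graph without isolated vertices has a set of
  2 <= k <= n / 2 vertices that no edge leaves. For large k these are ruled out by the union bound
  over all such sets; for bounded k the expected number of them does not vanish, but since the set
  must in addition contain an edge there is a further factor m e n / n --> 0.
*)
theory Submission
  imports Defs
begin

section \<open>Separated vertex sets\<close>

text \<open>At the threshold \<open>m / n\<close> is of order \<open>ln n\<close>, and the weight
  \<open>X h\<close> has little more than a first moment: two vertices are both touched by one
  community with probability bounded by \<open>e n / n\<close> only, not by O(1 / n^2). Every error
  term picks up the factor \<open>m / n\<close>, so \<open>e s * ln s --> 0\<close> is just the rate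
  needed, at \<open>s = n\<close> for isolated vertices and at \<open>s = n / k\<close> for cuts. In
  the union bound over k-sets the loss in the exponent is \<open>k * e (n / k) * ln n\<close> up to
  a constant. Write \<open>ln n = ln (n / k) + ln k\<close>: the first part costs O(k), the second a
  small multiple of \<open>k ln k\<close>, which the factorial in the binomial coefficient absorbs.
  When k is of order n, \<open>e (n / k)\<close> need not be small; there the crude rate
  \<open>E (Q 1{X >= 2}) k / n\<close> is enough, since \<open>m k / n\<close> is at least of order
  \<open>n ln n\<close> and there are only \<open>2^n\<close> sets. For bounded k a first moment
  bound on separated sets cannot succeed in the critical regime, because k isolated vertices already
  form a separated set. Asking for an edge inside excludes these.\<close>

definition isolated :: "nat set set \<Rightarrow> nat \<Rightarrow> bool" where
  "isolated E v \<longleftrightarrow> (\<forall>e\<in>E. v \<notin> e)"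

definition separated :: "nat set set \<Rightarrow> nat set \<Rightarrow> bool" where
  "separated E S \<longleftrightarrow> (\<forall>e\<in>E. e \<subseteq> S \<or> e \<inter> S = {})"

lemma separated_singleton_iff_isolated:
  assumes "E \<subseteq> pairs V"
  shows "separated E {v} \<longleftrightarrow> isolated E v"
proof -
  have "\<not> e \<subseteq> {v}" if "e \<in> E" for e
  proof
    assume "e \<subseteq> {v}"
    then have "card e \<le> card {v}" by (intro card_mono) auto
    with that assms show False by (auto simp: pairs_def)
  qed
  then show ?thesis unfolding separated_def isolated_def by blast
qed

text \<open>The set reached from a vertex that does not reach everything is separated, and so is its
  complement; one of the two has at most half of the vertices. This keeps the fraction
  \<open>card S / n\<close> in the range where the bounds on cuts hold.\<close>

lemma disconnected_obtains_separated:
  assumes E: "E \<subseteq> pairs {1..n}" and "n \<ge> 1" and "\<not> connected_graph ({1..n}, E)"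
  obtains S where "S \<subseteq> {1..n}" "S \<noteq> {}" "2 * card S \<le> n" "separated E S"
proof -
  let ?R = "{(a, b). {a, b} \<in> E}"
  have "{1..n} \<noteq> {}" using assms(2) by simp
  with assms(3) obtain u v where uv: "u \<in> {1..n}" "v \<in> {1..n}" "(u, v) \<notin> ?R\<^sup>*"
    by (auto simp: connected_graph_def)
  define T where "T = {w \<in> {1..n}. (u, w) \<in> ?R\<^sup>*}"
  have T: "T \<subseteq> {1..n}" "u \<in> T" "v \<notin> T" using uv by (auto simp: T_def)
  have sep: "separated E T"
    unfolding separated_def
  proof
    fix e assume e: "e \<in> E"
    then obtain a b where ab: "e = {a, b}" "a \<in> {1..n}" "b \<in> {1..n}"
      using E by (auto simp: pairs_def card_2_iff)
    then have "(a, b) \<in> ?R" "(b, a) \<in> ?R" using e by (auto simp: insert_commute)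
    then have "a \<in> T \<longleftrightarrow> b \<in> T" using ab(2,3)
      unfolding T_def by (auto intro: rtrancl_into_rtrancl)
    then show "e \<subseteq> T \<or> e \<inter> T = {}" by (auto simp: ab(1))
  qed
  have sep': "separated E ({1..n} - T)"
    unfolding separated_def
  proof
    fix e assume e: "e \<in> E"
    then have "e \<subseteq> {1..n}" using E by (auto simp: pairs_def)
    with sep e show "e \<subseteq> {1..n} - T \<or> e \<inter> ({1..n} - T) = {}"
      unfolding separated_def by blast
  qed
  have "card T + card ({1..n} - T) = n"
    using T(1) by (simp add: card_Diff_subset finite_subset) (metis T(1) card_atLeastAtMost card_mono diff_Suc_1 finite_atLeastAtMost le_add_diff_inverse)
  then consider "2 * card T \<le> n" | "2 * card ({1..n} - T) \<le> n" by linarith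
  then show ?thesis
  proof cases
    case 1
    then show ?thesis using that[of T] T sep by blast
  next
    case 2
    moreover have "{1..n} - T \<noteq> {}" using uv T by blast
    ultimately show ?thesis using that[of "{1..n} - T"] sep' by blast
  qed
qed

lemma connected_graph_not_isolated:
  assumes "connected_graph ({1..n}, E)" "n \<ge> 2" "v \<in> {1..n}"
  shows "\<not> isolated E v"
proof
  assume iso: "isolated E v"
  obtain w where w: "w \<in> {1..n}" "w \<noteq> v"
    using assms(2) by (metis One_nat_def atLeastAtMost_iff le_refl numeral_2_eq_2 Suc_n_not_le_n Suc_leD)
  have "(v, w) \<in> {(a, b). {a, b} \<in> E}\<^sup>*"
    using assms w by (auto simp: connected_graph_def)
  then show False
    using iso w(2) by (cases rule: converse_rtranclE) (auto simp: isolated_def)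
qed

section \<open>A single community\<close>

lemma prob_random_edges_avoid:
  assumes "finite V" "F \<subseteq> pairs V" "0 \<le> q" "q \<le> 1"
  shows "measure_pmf.prob (random_edges_pmf V q) {E. E \<inter> F = {}} = (1 - q) ^ card F"
proof -
  have fin: "finite (pairs V)" using assms(1) by (rule finite_pairs)
  let ?B = "\<lambda>e. if e \<in> F then {False} else UNIV"
  have "measure_pmf.prob (random_edges_pmf V q) {E. E \<inter> F = {}}
    = measure_pmf.prob (Pi_pmf (pairs V) False (\<lambda>_. bernoulli_pmf q)) (Pi (pairs V) ?B)"
    using assms(2) unfolding random_edges_pmf_def measure_map_pmf vimage_def
    by (intro arg_cong[where f = "measure_pmf.prob _"]) (auto simp: Pi_def split: if_splits)
  also have "\<dots> = (\<Prod>e\<in>pairs V. measure_pmf.prob (bernoulli_pmf q) (?B e))"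
    using fin by (rule measure_Pi_pmf_Pi)
  also have "\<dots> = (\<Prod>e\<in>F. 1 - q)"
    using assms fin
    by (intro prod.mono_neutral_cong_right) (auto simp: measure_pmf_single)
  finally show ?thesis by simp
qed

lemma prob_random_edges_le_avoid:
  assumes "finite V" "F \<subseteq> pairs V" "0 \<le> q" "q \<le> 1"
    and "\<And>E. E \<subseteq> pairs V \<Longrightarrow> P E \<Longrightarrow> E \<inter> F = {}"
  shows "measure_pmf.prob (random_edges_pmf V q) {E. P E} \<le> (1 - q) ^ card F"
proof -
  have "measure_pmf.prob (random_edges_pmf V q) {E. P E}
      \<le> measure_pmf.prob (random_edges_pmf V q) {E. E \<inter> F = {}}"
    using assms(5) set_random_edges[of V q]
    by (intro measure_pmf.finite_measure_mono_AE) (auto simp: AE_measure_pmf_iff)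
  with prob_random_edges_avoid[OF assms(1-4)] show ?thesis by simp
qed

text \<open>The \<open>card V - 1\<close> pairs through \<open>v\<close> are all absent with
  probability \<open>(1 - q) ^ (card V - 1)\<close>: \<open>h\<close> is the probability that a
  given member of a community receives an edge from it.\<close>

lemma prob_random_edges_not_isolated:
  assumes "finite V" "v \<in> V" "0 \<le> q" "q \<le> 1"
  shows "measure_pmf.prob (random_edges_pmf V q) {E. \<not> isolated E v} \<le> h (card V) q"
proof -
  let ?F = "(\<lambda>w. {v, w}) ` (V - {v})"
  have F: "?F \<subseteq> pairs V" using assms(2) by (auto simp: pairs_def card_insert_if)
  have "inj_on (\<lambda>w. {v, w}) (V - {v})" by (auto simp: inj_on_def doubleton_eq_iff)
  then have card: "card ?F = card V - 1" using assms by (simp add: card_image)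
  have "measure_pmf.prob (random_edges_pmf V q) {E. \<not> isolated E v}
      \<le> measure_pmf.prob (random_edges_pmf V q) (- {E. E \<inter> ?F = {}})"
  proof (intro measure_pmf.finite_measure_mono_AE)
    show "AE E in measure_pmf (random_edges_pmf V q). E \<in> {E. \<not> isolated E v} \<longrightarrow> E \<in> - {E. E \<inter> ?F = {}}"
      unfolding AE_measure_pmf_iff
    proof (intro ballI impI)
      fix E assume "E \<in> set_pmf (random_edges_pmf V q)" and "E \<in> {E. \<not> isolated E v}"
      then obtain e where "e \<in> E" "v \<in> e" "e \<subseteq> V" "card e = 2"
        using set_random_edges[of V q] by (auto simp: isolated_def pairs_def)
      then have "e \<in> ?F" by (auto simp: card_2_iff)
      with \<open>e \<in> E\<close> show "E \<in> - {E. E \<inter> ?F = {}}" by blast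
    qed
  qed auto
  also have "\<dots> = 1 - (1 - q) ^ (card V - 1)"
    using prob_random_edges_avoid[OF assms(1) F assms(3,4)] card
      measure_pmf.prob_compl[of "{E. E \<inter> ?F = {}}" "random_edges_pmf V q"]
    by (simp add: Compl_eq_Diff_UNIV)
  finally show ?thesis by (simp add: h_def)
qed

lemma prob_random_edges_isolated_outside:
  assumes "v \<notin> V"
  shows "measure_pmf.prob (random_edges_pmf V q) {E. \<not> isolated E v} = 0"
proof -
  have "\<not> isolated E v \<longrightarrow> False" if "E \<in> set_pmf (random_edges_pmf V q)" for E
    using that set_random_edges[of V q] assms by (auto simp: isolated_def pairs_def)
  then show ?thesis
    by (subst measure_pmf.prob_eq_0) (auto simp: AE_measure_pmf_iff)
qed

text \<open>A community cut by \<open>S\<close> has at least \<open>card V - 1\<close> crossing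
  pairs, as many as there are pairs through one vertex. So the same \<open>h\<close> governs
  isolation and separation, and the rate for k vertices can come out as about k times the rate for
  one.\<close>

lemma prob_random_edges_separated:
  assumes "finite V" "V \<inter> S \<noteq> {}" "\<not> V \<subseteq> S" "0 \<le> q" "q \<le> 1"
  shows "measure_pmf.prob (random_edges_pmf V q) {E. separated E S} \<le> 1 - h (card V) q"
proof -
  obtain a b where ab: "a \<in> V" "a \<in> S" "b \<in> V" "b \<notin> S" using assms by blast
  \<comment> \<open>A double star with centres \<open>a\<close> and \<open>b\<close>: vertices in
    \<open>S\<close> are joined to \<open>b\<close>, the others to \<open>a\<close>. Both centres
    would give \<open>{a, b}\<close>, so \<open>a\<close> is left out to make the map
    injective.\<close>
  let ?f = "\<lambda>w. if w \<in> S then {w, b} else {a, w}"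
  let ?F = "?f ` (V - {a})"
  have F: "?F \<subseteq> pairs V" using ab by (auto simp: pairs_def card_insert_if)
  have "inj_on ?f (V - {a})" using ab by (auto simp: inj_on_def doubleton_eq_iff)
  then have "card ?F = card (V - {a})" by (rule card_image)
  also have "\<dots> = card V - 1" using assms(1) ab(1) by simp
  finally have card: "card ?F = card V - 1" .
  have "measure_pmf.prob (random_edges_pmf V q) {E. separated E S} \<le> (1 - q) ^ card ?F"
  proof (intro prob_random_edges_le_avoid assms F)
    fix E assume E: "separated E S"
    have "?f w \<notin> E" for w
      using E ab by (auto simp: separated_def)
    then show "E \<inter> ?F = {}" by blast
  qed
  then show ?thesis unfolding card h_def by simp
qed

section \<open>Averaging over the uniformly random vertex set of a community\<close>

definition edges_pmf :: "nat \<Rightarrow> nat \<Rightarrow> real \<Rightarrow> nat set set pmf" where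
  "edges_pmf n x q = map_pmf snd (community_pmf n x q)"

lemma prob_edges_pmf:
  assumes "x \<le> n"
  shows "measure_pmf.prob (edges_pmf n x q) A =
    (\<Sum>V | V \<subseteq> {1..n} \<and> card V = x. measure_pmf.prob (random_edges_pmf V q) A) / (n choose x)"
proof -
  let ?S = "{V. V \<subseteq> {1..n} \<and> card V = x}"
  have fin: "finite (set_pmf (random_edges_pmf V q))" if "V \<in> ?S" for V
  proof -
    have "finite V" using that finite_subset by auto
    then show ?thesis using set_random_edges[of V q] finite_pairs finite_subset by blast
  qed
  have eq: "edges_pmf n x q = bind_pmf (pmf_of_set ?S) (\<lambda>V. random_edges_pmf V q)"
    by (simp add: edges_pmf_def community_pmf_def map_bind_pmf bind_return_pmf' )
  have "measure_pmf.prob (edges_pmf n x q) A = measure_pmf.expectation (edges_pmf n x q) (indicator A)"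
    by simp
  also have "\<dots> = (\<Sum>V\<in>?S. measure_pmf.expectation (random_edges_pmf V q) (indicator A) /\<^sub>R real (card ?S))"
    unfolding eq using subsets_of_card[OF assms] fin by (rule pmf_expectation_bind_pmf_of_set)
  also have "card ?S = n choose x" using n_subsets[of "{1..n}" x] by simp
  finally show ?thesis by (simp add: divide_inverse mult.commute sum_distrib_left[symmetric] del: One_nat_def)
qed

text \<open>The falling factorials are compared factor by factor,
  \<open>(a - i) / (n - i) <= a / n\<close>. Without division and in the naturals, truncated
  subtraction also covers \<open>x > n\<close>.\<close>

lemma choose_mult_power_le:
  assumes "a \<le> n"
  shows "(a choose x) * n ^ x \<le> a ^ x * (n choose x)"
proof (induction x)
  case (Suc x)
  have absorb: "Suc x * (b choose Suc x) = (b - x) * (b choose x)" for b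
    by (simp only: binomial_absorption binomial_absorb_comp)
  have le: "(a - x) * n \<le> a * (n - x)"
    using assms by (simp add: algebra_simps diff_mult_distrib diff_mult_distrib2) (metis mult.commute mult_le_mono2 diff_le_mono2)
  have "Suc x * ((a choose Suc x) * n ^ Suc x) = ((a - x) * n) * ((a choose x) * n ^ x)"
    using absorb[of a] by (simp only: power_Suc mult_ac) (metis mult.assoc mult.commute)
  also have "\<dots> \<le> (a * (n - x)) * (a ^ x * (n choose x))"
    using le Suc.IH by (rule mult_le_mono)
  also have "\<dots> = a ^ Suc x * ((n - x) * (n choose x))"
    by (simp only: power_Suc mult_ac)
  also have "\<dots> = Suc x * (a ^ Suc x * (n choose Suc x))"
    unfolding absorb[of n, symmetric] by (simp only: mult_ac)
  finally show ?case by (simp only: mult_le_cancel1)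
qed simp

lemma choose_ratio_le:
  assumes "a \<le> n" "x \<le> n"
  shows "real (a choose x) / real (n choose x) \<le> (real a / real n) ^ x"
proof (cases "n = 0")
  case False
  have "real (a choose x) * real n ^ x \<le> real a ^ x * real (n choose x)"
    using choose_mult_power_le[OF assms(1), of x] by (metis of_nat_le_iff of_nat_mult of_nat_power)
  moreover have "n choose x > 0" using assms by simp
  ultimately show ?thesis using False by (simp add: field_simps)
qed (use assms in simp)

text \<open>Counting pairs \<open>W \<subseteq> V\<close> in two ways turns the left-hand side into
  \<open>x choose w\<close> over \<open>n choose w\<close> with \<open>w = card W\<close>, so
  \<open>choose_ratio_le\<close> applies with \<open>x\<close> as the upper and \<open>w\<close> as
  the lower index.\<close>

lemma card_supersets_ratio_le:
  assumes "W \<subseteq> {1..n}" "x \<le> n"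
  shows "real (card {V. V \<subseteq> {1..n} \<and> card V = x \<and> W \<subseteq> V}) / real (n choose x) \<le> (real x / real n) ^ card W"
    (is "real (card ?A) / _ \<le> _")
proof (cases "card W \<le> x")
  case True
  have finW: "finite W" using assms finite_subset by auto
  have "bij_betw (\<lambda>V. V - W) ?A {B. B \<subseteq> {1..n} - W \<and> card B = x - card W}"
  proof (rule bij_betw_byWitness[where f' = "\<lambda>B. B \<union> W"])
    show "(\<lambda>V. V - W) ` ?A \<subseteq> {B. B \<subseteq> {1..n} - W \<and> card B = x - card W}"
      using finW by (auto simp: card_Diff_subset)
    show "(\<lambda>B. B \<union> W) ` {B. B \<subseteq> {1..n} - W \<and> card B = x - card W} \<subseteq> ?A"
    proof (clarify, intro conjI)
      fix B assume B: "B \<subseteq> {1..n} - W" "card B = x - card W"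
      then have "finite B" by (auto intro: finite_subset)
      then have "card (B \<union> W) = card B + card W"
        using B finW by (intro card_Un_disjoint) auto
      then show "card (B \<union> W) = x" using B True by simp
    qed (use assms in auto)
  qed auto
  then have "card ?A = card {B. B \<subseteq> {1..n} - W \<and> card B = x - card W}"
    by (rule bij_betw_same_card)
  also have "\<dots> = card ({1..n} - W) choose (x - card W)" by (rule n_subsets) simp
  also have "card ({1..n} - W) = n - card W" using assms finW by (simp add: card_Diff_subset)
  finally have A: "card ?A = (n - card W) choose (x - card W)" .
  have "(n choose x) * (x choose card W) = (n choose card W) * card ?A"
    unfolding A using True assms(2) by (rule choose_mult)
  then have "real (n choose x) * real (x choose card W) = real (n choose card W) * real (card ?A)"
    by (metis of_nat_mult)
  moreover have "n choose x > 0" "n choose card W > 0" using assms True by auto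
  ultimately have "real (card ?A) / real (n choose x) = real (x choose card W) / real (n choose card W)"
    by (simp add: field_simps)
  also have "\<dots> \<le> (real x / real n) ^ card W"
    using assms True by (intro choose_ratio_le) auto
  finally show ?thesis .
next
  case False
  have "?A = {}"
  proof -
    have "card W \<le> card V" if "V \<subseteq> {1..n}" "W \<subseteq> V" for V
      using that by (meson card_mono finite_atLeastAtMost finite_subset)
    then show ?thesis using False by auto
  qed
  then show ?thesis by (simp only: card.empty) simp
qed

lemma h_bounds:
  assumes "0 \<le> q" "q \<le> 1"
  shows "0 \<le> h x q" "h x q \<le> 1"
  using assms by (auto simp: h_def power_le_one)

text \<open>All of \<open>W\<close> must lie in the random vertex set; given that, only one element
  of \<open>W\<close> is asked to have an edge. A single factor \<open>h\<close> next to
  \<open>(x / n) ^ card W\<close> is what leads to \<open>X h min (1, X / n) / n\<close> for two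
  vertices.\<close>

lemma prob_edges_not_isolated_all:
  assumes "x \<le> n" "W \<subseteq> {1..n}" "W \<noteq> {}" "0 \<le> q" "q \<le> 1"
  shows "measure_pmf.prob (edges_pmf n x q) {E. \<forall>v\<in>W. \<not> isolated E v}
    \<le> (real x / real n) ^ card W * h x q"
proof -
  let ?S = "{V. V \<subseteq> {1..n} \<and> card V = x}"
  let ?A = "{V. V \<subseteq> {1..n} \<and> card V = x \<and> W \<subseteq> V}"
  have fin: "finite ?S" using subsets_of_card[OF assms(1)] by simp
  obtain w where w: "w \<in> W" using assms by blast
  have "(\<Sum>V\<in>?S. measure_pmf.prob (random_edges_pmf V q) {E. \<forall>v\<in>W. \<not> isolated E v})
      \<le> (\<Sum>V\<in>?S. if W \<subseteq> V then h x q else 0)"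
  proof (intro sum_mono)
    fix V assume V: "V \<in> ?S"
    then have "finite V" by (auto intro: finite_subset)
    have le: "measure_pmf.prob (random_edges_pmf V q) {E. \<forall>v\<in>W. \<not> isolated E v}
      \<le> measure_pmf.prob (random_edges_pmf V q) {E. \<not> isolated E u}" if "u \<in> W" for u
      using that by (intro measure_pmf.finite_measure_mono) auto
    show "measure_pmf.prob (random_edges_pmf V q) {E. \<forall>v\<in>W. \<not> isolated E v}
        \<le> (if W \<subseteq> V then h x q else 0)"
    proof (cases "W \<subseteq> V")
      case True
      then show ?thesis
        using prob_random_edges_not_isolated[of V w q] le[OF w] w V \<open>finite V\<close> assms by auto
    next
      case False
      then obtain u where "u \<in> W" "u \<notin> V" by blast
      then show ?thesis using le[of u] prob_random_edges_isolated_outside[of u V q] False by simp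
    qed
  qed
  also have "\<dots> = (\<Sum>V\<in>?A. h x q)"
    by (intro sum.mono_neutral_cong_right fin) auto
  also have "\<dots> = real (card ?A) * h x q" by simp
  finally have "measure_pmf.prob (edges_pmf n x q) {E. \<forall>v\<in>W. \<not> isolated E v}
    \<le> (real (card ?A) * h x q) / real (n choose x)"
    unfolding prob_edges_pmf[OF assms(1)] by (intro divide_right_mono) auto
  also have "\<dots> = (real (card ?A) / real (n choose x)) * h x q" by simp
  also have "\<dots> \<le> (real x / real n) ^ card W * h x q"
    using assms by (intro mult_right_mono card_supersets_ratio_le h_bounds) auto
  finally show ?thesis .
qed

text \<open>The vertex set lies inside \<open>S\<close> with probability at most
  \<open>t ^ x\<close> and outside with probability at most \<open>(1 - t) ^ x\<close>; otherwise it
  is cut and separation costs a factor \<open>1 - h x q\<close>.\<close>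

lemma prob_edges_separated:
  assumes "x \<le> n" "S \<subseteq> {1..n}" "0 \<le> q" "q \<le> 1" "n \<ge> 1"
  defines "t \<equiv> real (card S) / real n"
  shows "measure_pmf.prob (edges_pmf n x q) {E. separated E S}
    \<le> 1 - h x q * (1 - (1 - t) ^ x - t ^ x)"
proof -
  let ?S = "{V. V \<subseteq> {1..n} \<and> card V = x}"
  let ?B = "{V. V \<subseteq> S \<and> card V = x}"
  let ?C = "{V. V \<subseteq> {1..n} - S \<and> card V = x}"
  have finS: "finite S" using assms finite_subset by auto
  have fin: "finite ?S" using subsets_of_card[OF assms(1)] by simp
  have sub: "?B \<union> ?C \<subseteq> ?S" using assms by auto
  have kn: "card S \<le> n" using assms(2) card_mono[of "{1..n}" S] by simp
  have "card ?S = n choose x" using n_subsets[of "{1..n}" x] by simp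
  moreover have "card ?B = card S choose x" using finS by (rule n_subsets)
  moreover have "card ?C = (n - card S) choose x"
    using n_subsets[of "{1..n} - S" x] finS assms(2) by (simp add: card_Diff_subset)
  ultimately have cards: "card ?S = n choose x" "card ?B = card S choose x"
    "card ?C = (n - card S) choose x" .
  have "(\<Sum>V\<in>?S. measure_pmf.prob (random_edges_pmf V q) {E. separated E S})
      \<le> (\<Sum>V\<in>?S. 1 - h x q + (if V \<in> ?B \<union> ?C then h x q else 0))"
  proof (intro sum_mono)
    fix V assume V: "V \<in> ?S"
    then have "finite V" by (auto intro: finite_subset)
    show "measure_pmf.prob (random_edges_pmf V q) {E. separated E S}
        \<le> 1 - h x q + (if V \<in> ?B \<union> ?C then h x q else 0)"
    proof (cases "V \<in> ?B \<union> ?C")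
      case False
      then have "V \<inter> S \<noteq> {}" "\<not> V \<subseteq> S" using V by blast+
      then show ?thesis
        using prob_random_edges_separated[of V S q] V \<open>finite V\<close> assms(3,4)
        unfolding if_not_P[OF False] by simp
    qed simp
  qed
  also have "\<dots> = (1 - h x q) * (n choose x) + h x q * real (card (?B \<union> ?C))"
  proof -
    have "(\<Sum>V\<in>?S. if V \<in> ?B \<union> ?C then h x q else 0) = (\<Sum>V\<in>?B \<union> ?C. h x q)"
      by (rule sum.mono_neutral_cong_right[OF fin sub]) auto
    then show ?thesis by (simp only: sum.distrib sum_constant cards(1)) (simp add: mult.commute)
  qed
  \<comment> \<open>Only an inequality, as \<open>?B\<close> and \<open>?C\<close> share the empty
    set when \<open>x = 0\<close>.\<close>
  also have "\<dots> \<le> (1 - h x q) * (n choose x) + h x q * real (card ?B + card ?C)"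
    using card_Un_le[of ?B ?C] h_bounds[of q x] assms
    by (intro add_left_mono mult_left_mono) (simp_all del: of_nat_add)
  finally have "measure_pmf.prob (edges_pmf n x q) {E. separated E S}
     \<le> ((1 - h x q) * (n choose x) + h x q * real (card ?B + card ?C)) / real (n choose x)"
    unfolding prob_edges_pmf[OF assms(1)] by (intro divide_right_mono) auto
  also have "\<dots> = 1 - h x q + h x q * (real ((n - card S) choose x) / real (n choose x) + real (card S choose x) / real (n choose x))"
    using assms(1) unfolding of_nat_add cards
    by (simp add: add_divide_distrib distrib_left del: One_nat_def)
  also have "\<dots> \<le> 1 - h x q + h x q * ((real (n - card S) / real n) ^ x + (real (card S) / real n) ^ x)"
    using h_bounds[of q x] assms kn
    by (intro add_left_mono mult_left_mono add_mono choose_ratio_le) simp_all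
  also have "real (n - card S) / real n = 1 - t"
    using kn assms(5) by (simp add: t_def of_nat_diff diff_divide_distrib)
  finally show ?thesis unfolding t_def by argo
qed

section \<open>The mixed edge set\<close>

lemma set_edges_pmf:
  assumes "x \<le> n"
  shows "set_pmf (edges_pmf n x q) \<subseteq> Pow (pairs {1..n})"
  using set_community[OF assms, of q] unfolding edges_pmf_def set_map_pmf by fastforce

lemma prob_eq_sum_pmf:
  assumes "finite S" "set_pmf p \<subseteq> S"
  shows "measure_pmf.prob p A = (\<Sum>x\<in>S \<inter> A. pmf p x)"
proof -
  have "measure_pmf.prob p A = measure_pmf.prob p (S \<inter> A)"
    using assms(2) by (intro measure_eq_AE) (auto simp: AE_measure_pmf_iff)
  then show ?thesis using assms(1) by (simp add: measure_measure_pmf_finite)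
qed

lemma measurable_pmf_edges:
  assumes X: "X \<in> measurable M (count_space UNIV)" "\<And>\<omega>. \<omega> \<in> space M \<Longrightarrow> X \<omega> \<le> n"
    and Q: "Q \<in> borel_measurable M" "\<And>\<omega>. \<omega> \<in> space M \<Longrightarrow> Q \<omega> \<in> {0..1}"
  shows "(\<lambda>\<omega>. pmf (edges_pmf n (X \<omega>) (Q \<omega>)) E) \<in> borel_measurable M"
  unfolding edges_pmf_def
proof (rule measurable_pmf_map[where S = "Pow {1..n} \<times> Pow (pairs {1..n})"])
  show "finite (Pow {1..n} \<times> Pow (pairs {1..n}))" by (simp add: finite_pairs)
qed (use set_community X(2) measurable_pmf_community[OF assms] in auto)

lemma union_graph_pmf_eq:
  "union_graph_pmf n m x q =
    map_pmf (\<lambda>E. ({1..n}, \<Union>i\<in>{1..m}. E i)) (Pi_pmf {1..m} {} (\<lambda>i. edges_pmf n (x i) (q i)))"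
proof -
  have "Pi_pmf {1..m} {} (\<lambda>i. edges_pmf n (x i) (q i))
    = map_pmf (\<lambda>G. snd \<circ> G) (Pi_pmf {1..m} ({}, {}) (\<lambda>i. community_pmf n (x i) (q i)))"
    unfolding edges_pmf_def by (rule Pi_pmf_map) auto
  then show ?thesis
    unfolding union_graph_pmf_def by (simp add: map_pmf_comp)
qed

section \<open>Averaging over the random sizes and densities\<close>

locale iid_communities = prob_space M for M :: "'a measure" +
  fixes X :: "nat \<Rightarrow> 'a \<Rightarrow> nat" and Q :: "nat \<Rightarrow> 'a \<Rightarrow> real"
  assumes Q_range: "\<And>i \<omega>. \<omega> \<in> space M \<Longrightarrow> Q i \<omega> \<in> {0..1}"
    and indep: "indep_vars (\<lambda>_. count_space UNIV \<Otimes>\<^sub>M borel) (\<lambda>i \<omega>. (X i \<omega>, Q i \<omega>)) UNIV"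
    and ident: "\<And>i. distr M (count_space UNIV \<Otimes>\<^sub>M borel) (\<lambda>\<omega>. (X i \<omega>, Q i \<omega>)) =
                     distr M (count_space UNIV \<Otimes>\<^sub>M borel) (\<lambda>\<omega>. (X 0 \<omega>, Q 0 \<omega>))"
begin

abbreviation N :: "(nat \<times> real) measure" where "N \<equiv> count_space UNIV \<Otimes>\<^sub>M borel"

lemma XQ_measurable: "(\<lambda>\<omega>. (X i \<omega>, Q i \<omega>)) \<in> measurable M N"
  using indep by (simp add: indep_vars_def)

lemma X_measurable [measurable]: "X i \<in> measurable M (count_space UNIV)"
  using measurable_compose[OF XQ_measurable measurable_fst] by simp

lemma Q_measurable [measurable]: "Q i \<in> borel_measurable M"
  using measurable_compose[OF XQ_measurable measurable_snd] by simp

lemma Q_bounds: "\<omega> \<in> space M \<Longrightarrow> 0 \<le> Q i \<omega>" "\<omega> \<in> space M \<Longrightarrow> Q i \<omega> \<le> 1"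
  using Q_range by auto

text \<open>Size and density are clamped because composition with the independent pairs calls for a
  function that is measurable on all of \<open>N\<close>, while the conditional law is meaningful
  only for sizes up to \<open>n\<close> and densities in the unit interval.\<close>

definition edges_density :: "nat \<Rightarrow> nat set set \<Rightarrow> nat \<times> real \<Rightarrow> real" where
  "edges_density n E z = pmf (edges_pmf n (min (fst z) n) (max 0 (min 1 (snd z)))) E"

lemma edges_density_measurable: "edges_density n E \<in> borel_measurable N"
proof -
  have "(\<lambda>z. min (fst z) n) \<in> measurable N (count_space UNIV)"
    by (rule measurable_compose[OF measurable_fst]) simp
  moreover have "(\<lambda>z. max 0 (min 1 (snd z)) :: real) \<in> borel_measurable N"
    by measurable
  ultimately show ?thesis
    unfolding edges_density_def by (intro measurable_pmf_edges) auto
qed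

lemma edges_density_eq:
  "\<omega> \<in> space M \<Longrightarrow> edges_density n E (X i \<omega>, Q i \<omega>) = pmf (edges_pmf n (min (X i \<omega>) n) (Q i \<omega>)) E"
  using Q_bounds[of \<omega> i] by (simp add: edges_density_def)

lemma pmf_edges_measurable [measurable]:
  "(\<lambda>\<omega>. pmf (edges_pmf n (min (X i \<omega>) n) (Q i \<omega>)) E) \<in> borel_measurable M"
  by (intro measurable_pmf_edges Q_measurable Q_range) auto

lemma pmf_edges_integrable:
  "integrable M (\<lambda>\<omega>. pmf (edges_pmf n (min (X i \<omega>) n) (Q i \<omega>)) E)"
  by (rule integrable_const_bound[where B = 1]) (auto simp: pmf_le_1)

text \<open>The unconditional law of the edge set of one community. It lives on finitely many edge
  sets, so it can be given by its averaged point masses.\<close>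

definition mixed_edges_pmf :: "nat \<Rightarrow> nat set set pmf" where
  "mixed_edges_pmf n = embed_pmf (\<lambda>E. expectation (\<lambda>\<omega>. pmf (edges_pmf n (min (X 0 \<omega>) n) (Q 0 \<omega>)) E))"

lemma pmf_mixed_edges:
  "pmf (mixed_edges_pmf n) E = expectation (\<lambda>\<omega>. pmf (edges_pmf n (min (X 0 \<omega>) n) (Q 0 \<omega>)) E)"
  unfolding mixed_edges_pmf_def
proof (rule pmf_embed_pmf)
  let ?f = "\<lambda>E. expectation (\<lambda>\<omega>. pmf (edges_pmf n (min (X 0 \<omega>) n) (Q 0 \<omega>)) E)"
  let ?S = "Pow (pairs {1..n})"
  show nonneg: "0 \<le> ?f E" for E by (intro integral_nonneg_AE) auto
  have "?f E = 0" if "E \<notin> ?S" for E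
  proof -
    have "pmf (edges_pmf n (min (X 0 \<omega>) n) (Q 0 \<omega>)) E = 0" for \<omega>
      using that set_edges_pmf[of "min (X 0 \<omega>) n" n "Q 0 \<omega>"] by (auto simp: set_pmf_iff)
    then show ?thesis by simp
  qed
  then have "(\<integral>\<^sup>+E. ennreal (?f E) \<partial>count_space UNIV) = (\<Sum>E\<in>?S. ennreal (?f E))"
    by (intro nn_integral_count_space') (auto simp: finite_pairs)
  also have "\<dots> = ennreal (\<Sum>E\<in>?S. ?f E)"
    using nonneg by (rule sum_ennreal)
  also have "(\<Sum>E\<in>?S. ?f E) = expectation (\<lambda>\<omega>. \<Sum>E\<in>?S. pmf (edges_pmf n (min (X 0 \<omega>) n) (Q 0 \<omega>)) E)"
    by (rule Bochner_Integration.integral_sum[symmetric]) (rule pmf_edges_integrable)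
  also have "\<dots> = 1"
  proof -
    have "(\<Sum>E\<in>?S. pmf (edges_pmf n (min (X 0 \<omega>) n) (Q 0 \<omega>)) E) = 1" for \<omega>
      by (intro sum_pmf_eq_1 set_edges_pmf) (simp_all add: finite_pairs)
    then show ?thesis by (simp add: prob_space del: One_nat_def)
  qed
  finally show "(\<integral>\<^sup>+E. ennreal (?f E) \<partial>count_space UNIV) = 1" by simp
qed

lemma set_mixed_edges_pmf: "set_pmf (mixed_edges_pmf n) \<subseteq> Pow (pairs {1..n})"
proof (rule subsetI, rule ccontr)
  fix E assume E: "E \<in> set_pmf (mixed_edges_pmf n)" "E \<notin> Pow (pairs {1..n})"
  have "pmf (edges_pmf n (min (X 0 \<omega>) n) (Q 0 \<omega>)) E = 0" for \<omega>
    using E(2) set_edges_pmf[of "min (X 0 \<omega>) n" n "Q 0 \<omega>"]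
    unfolding set_pmf_iff[symmetric] by (simp add: pmf_eq_0_set_pmf) blast
  then have "pmf (mixed_edges_pmf n) E = 0" by (simp add: pmf_mixed_edges)
  with E(1) show False by (simp add: set_pmf_iff)
qed

lemma prob_mixed_edges:
  "measure_pmf.prob (mixed_edges_pmf n) A
    = expectation (\<lambda>\<omega>. measure_pmf.prob (edges_pmf n (min (X 0 \<omega>) n) (Q 0 \<omega>)) A)"
proof -
  let ?S = "Pow (pairs {1..n})"
  have fin: "finite ?S" by (simp add: finite_pairs)
  have "measure_pmf.prob (mixed_edges_pmf n) A = (\<Sum>E\<in>?S \<inter> A. pmf (mixed_edges_pmf n) E)"
    using fin set_mixed_edges_pmf by (rule prob_eq_sum_pmf)
  also have "\<dots> = expectation (\<lambda>\<omega>. \<Sum>E\<in>?S \<inter> A. pmf (edges_pmf n (min (X 0 \<omega>) n) (Q 0 \<omega>)) E)"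
    unfolding pmf_mixed_edges
    by (rule Bochner_Integration.integral_sum[symmetric]) (rule pmf_edges_integrable)
  also have "\<dots> = expectation (\<lambda>\<omega>. measure_pmf.prob (edges_pmf n (min (X 0 \<omega>) n) (Q 0 \<omega>)) A)"
    by (simp only: prob_eq_sum_pmf[OF fin set_edges_pmf[OF min.cobounded2]])
  finally show ?thesis .
qed

lemma prob_edges_measurable [measurable]:
  "(\<lambda>\<omega>. measure_pmf.prob (edges_pmf n (min (X i \<omega>) n) (Q i \<omega>)) A) \<in> borel_measurable M"
proof -
  let ?S = "Pow (pairs {1..n})"
  have "(\<lambda>\<omega>. measure_pmf.prob (edges_pmf n (min (X i \<omega>) n) (Q i \<omega>)) A)
    = (\<lambda>\<omega>. \<Sum>E\<in>?S \<inter> A. pmf (edges_pmf n (min (X i \<omega>) n) (Q i \<omega>)) E)"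
    by (simp only: prob_eq_sum_pmf[OF _ set_edges_pmf[OF min.cobounded2]] finite_Pow_iff
        finite_pairs finite_atLeastAtMost)
  then show ?thesis by simp
qed

lemma expectation_prod_pmf_edges:
  assumes "finite I"
  shows "expectation (\<lambda>\<omega>. \<Prod>i\<in>I. pmf (edges_pmf n (min (X i \<omega>) n) (Q i \<omega>)) (E i))
    = (\<Prod>i\<in>I. pmf (mixed_edges_pmf n) (E i))"
proof -
  let ?Y = "\<lambda>i \<omega>. edges_density n (E i) (X i \<omega>, Q i \<omega>)"
  have "indep_vars (\<lambda>_. borel) ?Y UNIV"
    by (rule indep_vars_compose2[OF indep]) (rule edges_density_measurable)
  then have ind: "indep_vars (\<lambda>_. borel) ?Y I" by (rule indep_vars_subset) simp
  have int: "integrable M (?Y i)" for i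
    using pmf_edges_integrable[of n i "E i"]
    by (simp add: edges_density_eq cong: Bochner_Integration.integrable_cong)
  have one: "expectation (?Y i) = pmf (mixed_edges_pmf n) (E i)" for i
  proof -
    \<comment> \<open>The mixed law is built from the pair of index 0, while the graph uses the
      indices from 1 on; equality in distribution carries the mean over.\<close>
    have "expectation (?Y i) = (\<integral>z. edges_density n (E i) z \<partial>distr M N (\<lambda>\<omega>. (X i \<omega>, Q i \<omega>)))"
      by (rule integral_distr[symmetric, OF XQ_measurable edges_density_measurable])
    also have "\<dots> = expectation (\<lambda>\<omega>. edges_density n (E i) (X 0 \<omega>, Q 0 \<omega>))"
      unfolding ident[of i] by (rule integral_distr[OF XQ_measurable edges_density_measurable])
    also have "\<dots> = pmf (mixed_edges_pmf n) (E i)"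
      unfolding pmf_mixed_edges by (rule Bochner_Integration.integral_cong) (auto simp: edges_density_eq)
    finally show ?thesis .
  qed
  have "expectation (\<lambda>\<omega>. \<Prod>i\<in>I. pmf (edges_pmf n (min (X i \<omega>) n) (Q i \<omega>)) (E i))
    = expectation (\<lambda>\<omega>. \<Prod>i\<in>I. ?Y i \<omega>)"
    by (rule Bochner_Integration.integral_cong) (auto simp: edges_density_eq)
  also have "\<dots> = (\<Prod>i\<in>I. expectation (?Y i))"
    using assms ind int by (rule indep_vars_lebesgue_integral)
  finally show ?thesis by (simp add: one)
qed

text \<open>Given the pairs, a family of edge sets has a product of point masses as its probability,
  and by independence of the pairs the expectation of this product factorizes. Hence conditional
  independence given i.i.d. pairs becomes plain independence with common law
  \<open>mixed_edges_pmf\<close>, and \<open>M\<close> disappears from the probabilities.\<close>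

lemma measure_random_graph_eq:
  "measure (random_graph M n m (\<lambda>i \<omega>. min (X i \<omega>) n) Q) A
    = measure_pmf.prob (Pi_pmf {1..m} {} (\<lambda>_. mixed_edges_pmf n)) {E. ({1..n}, \<Union>i\<in>{1..m}. E i) \<in> A}"
proof -
  let ?B = "{E. ({1..n}, \<Union>i\<in>{1..m}. E i) \<in> A}"
  \<comment> \<open>A finite carrier for all families that occur, so that expectations and sums may
    be exchanged.\<close>
  let ?T = "PiE_dflt {1..m} {} (\<lambda>_. Pow (pairs {1..n}))"
  let ?p = "\<lambda>\<omega>. Pi_pmf {1..m} {} (\<lambda>i. edges_pmf n (min (X i \<omega>) n) (Q i \<omega>))"
  have fin: "finite ?T" by (intro finite_PiE_dflt) (auto simp: finite_pairs)
  have sub: "set_pmf (Pi_pmf {1..m} {} p) \<subseteq> ?T" if "\<And>i. set_pmf (p i) \<subseteq> Pow (pairs {1..n})" for p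
  proof
    fix E assume "E \<in> set_pmf (Pi_pmf {1..m} {} p)"
    then have "E \<in> PiE_dflt {1..m} {} (set_pmf \<circ> p)"
      using set_Pi_pmf_subset'[of "{1..m}" "{}" p] by blast
    then show "E \<in> ?T" using that unfolding PiE_dflt_def o_def by blast
  qed
  have pmf_Pi: "pmf (Pi_pmf {1..m} {} p) E = (\<Prod>i\<in>{1..m}. pmf (p i) (E i))" if "E \<in> ?T" for E p
    using that by (subst Product_PMF.pmf_Pi) (simp_all add: PiE_dflt_def)
  have "measure (random_graph M n m (\<lambda>i \<omega>. min (X i \<omega>) n) Q) A
    = expectation (\<lambda>\<omega>. measure_pmf.prob (union_graph_pmf n m (\<lambda>i. min (X i \<omega>) n) (\<lambda>i. Q i \<omega>)) A)"
    using Q_range by (intro measure_random_graph) auto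
  also have "\<dots> = expectation (\<lambda>\<omega>. measure_pmf.prob (?p \<omega>) ?B)"
    by (simp only: union_graph_pmf_eq measure_map_pmf vimage_def)
  also have "\<dots> = expectation (\<lambda>\<omega>. \<Sum>E\<in>?T \<inter> ?B. \<Prod>i\<in>{1..m}. pmf (edges_pmf n (min (X i \<omega>) n) (Q i \<omega>)) (E i))"
  proof -
    have "measure_pmf.prob (?p \<omega>) ?B
      = (\<Sum>E\<in>?T \<inter> ?B. \<Prod>i\<in>{1..m}. pmf (edges_pmf n (min (X i \<omega>) n) (Q i \<omega>)) (E i))" for \<omega>
    proof -
      have "measure_pmf.prob (?p \<omega>) ?B = (\<Sum>E\<in>?T \<inter> ?B. pmf (?p \<omega>) E)"
        by (intro prob_eq_sum_pmf[OF fin] sub set_edges_pmf) simp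
      also have "\<dots> = (\<Sum>E\<in>?T \<inter> ?B. \<Prod>i\<in>{1..m}. pmf (edges_pmf n (min (X i \<omega>) n) (Q i \<omega>)) (E i))"
        by (rule sum.cong[OF refl]) (rule pmf_Pi, blast)
      finally show ?thesis .
    qed
    then show ?thesis by (simp only:)
  qed
  also have "\<dots> = (\<Sum>E\<in>?T \<inter> ?B. expectation (\<lambda>\<omega>. \<Prod>i\<in>{1..m}. pmf (edges_pmf n (min (X i \<omega>) n) (Q i \<omega>)) (E i)))"
  proof (intro Bochner_Integration.integral_sum integrable_const_bound[where B = 1] AE_I2)
    fix E \<omega>
    have "(\<Prod>i\<in>{1..m}. pmf (edges_pmf n (min (X i \<omega>) n) (Q i \<omega>)) (E i)) \<le> 1"
      by (intro prod_le_1) (simp add: pmf_le_1)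
    moreover have "0 \<le> (\<Prod>i\<in>{1..m}. pmf (edges_pmf n (min (X i \<omega>) n) (Q i \<omega>)) (E i))"
      by (intro prod_nonneg) simp
    ultimately show "norm (\<Prod>i\<in>{1..m}. pmf (edges_pmf n (min (X i \<omega>) n) (Q i \<omega>)) (E i)) \<le> 1"
      by simp
  qed (intro borel_measurable_prod pmf_edges_measurable)
  also have "\<dots> = (\<Sum>E\<in>?T \<inter> ?B. pmf (Pi_pmf {1..m} {} (\<lambda>_. mixed_edges_pmf n)) E)"
    by (rule sum.cong[OF refl]) (simp only: pmf_Pi Int_iff expectation_prod_pmf_edges finite_atLeastAtMost)
  also have "\<dots> = measure_pmf.prob (Pi_pmf {1..m} {} (\<lambda>_. mixed_edges_pmf n)) ?B"
    by (intro prob_eq_sum_pmf[symmetric] fin sub set_mixed_edges_pmf)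
  finally show ?thesis .
qed

end

section \<open>Estimates under the moment condition\<close>

lemma h_mono:
  assumes "x \<le> y" "0 \<le> q" "q \<le> 1"
  shows "h x q \<le> h y q"
  using assms by (auto simp: h_def intro!: power_decreasing)

lemma h_eq_0: "x \<le> 1 \<Longrightarrow> h x q = 0"
  by (simp add: h_def)

lemma h_ge:
  assumes "2 \<le> x" "0 \<le> q" "q \<le> 1"
  shows "q \<le> h x q"
proof -
  have "(1 - q) ^ (x - 1) \<le> (1 - q) ^ 1"
    using assms by (intro power_decreasing) auto
  then show ?thesis by (simp add: h_def)
qed

text \<open>The second Bonferroni inequality for \<open>x\<close> independent events of probability
  \<open>t\<close>; the cubic term left over in the induction has the right sign.\<close>

lemma power_one_minus_le_quadratic:
  fixes t :: real
  assumes "0 \<le> t" "t \<le> 1"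
  shows "(1 - t) ^ x \<le> 1 - real x * t + real x * (real x - 1) / 2 * t\<^sup>2"
proof (induction x)
  case (Suc x)
  have "0 \<le> real x * (real x - 1) / 2 * t ^ 3"
    using assms by (cases x) auto
  moreover have "(1 - t) ^ Suc x \<le> (1 - t) * (1 - real x * t + real x * (real x - 1) / 2 * t\<^sup>2)"
    using Suc assms by (simp add: mult_left_mono)
  ultimately show ?case
    by (simp add: power2_eq_square power3_eq_cube field_simps)
qed simp

text \<open>Sharp to first order when \<open>x * t\<close> is small. Multiplied by \<open>h\<close>,
  the right factor becomes \<open>W * t * (1 - X * t)\<close>, which is where the truncation
  \<open>min 1 (X / s)\<close> with \<open>s = 1 / t\<close> comes from.\<close>

lemma split_prob_ge:
  fixes t :: real
  assumes "0 \<le> t" "t \<le> 1" "x \<ge> 2"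
  shows "real x * t * (1 - real x * t) \<le> 1 - (1 - t) ^ x - t ^ x"
proof -
  have "t ^ x \<le> t\<^sup>2" using assms by (intro power_decreasing) auto
  moreover have "(real x * (real x - 1) / 2 + 1) * t\<^sup>2 \<le> (real x)\<^sup>2 * t\<^sup>2"
  proof (intro mult_right_mono)
    have "2 * real x \<le> real x * real x" using assms(3) by (intro mult_right_mono) auto
    moreover have "(a - y) / 2 + 1 \<le> a" if "2 * y \<le> a" "2 \<le> y" for a y :: real
      using that by (simp add: field_simps)
    ultimately show "real x * (real x - 1) / 2 + 1 \<le> (real x)\<^sup>2"
      using assms(3) unfolding power2_eq_square right_diff_distrib by simp
  qed simp
  ultimately show ?thesis
    using power_one_minus_le_quadratic[OF assms(1,2), of x]
    by (simp add: power2_eq_square algebra_simps)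
qed

text \<open>The powers are largest at \<open>x = 2\<close>, where the right-hand side is
  \<open>2 * t * (1 - t)\<close>.\<close>

lemma split_prob_ge_linear:
  fixes t :: real
  assumes "0 \<le> t" "t \<le> 1 / 2" "x \<ge> 2"
  shows "t \<le> 1 - (1 - t) ^ x - t ^ x"
proof -
  have "t ^ x \<le> t\<^sup>2" "(1 - t) ^ x \<le> (1 - t)\<^sup>2" using assms by (auto intro!: power_decreasing)
  moreover have "t * t \<le> t * (1 / 2)" using assms by (intro mult_left_mono) auto
  ultimately show ?thesis by (simp add: power2_eq_square algebra_simps)
qed

lemma split_prob_nonneg:
  fixes t :: real
  assumes "0 \<le> t" "t \<le> 1" "x \<ge> 1"
  shows "0 \<le> 1 - (1 - t) ^ x - t ^ x"
proof -
  have "t ^ x \<le> t ^ 1" "(1 - t) ^ x \<le> (1 - t) ^ 1"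
    using assms by (intro power_decreasing; simp)+
  then show ?thesis by simp
qed

text \<open>This supplies the integrable majorant, and so consumes the logarithmic moment. For
  \<open>s > x\<close> write \<open>ln s = ln x + ln (s / x)\<close> and use
  \<open>ln u <= u\<close>, which leaves \<open>ln x + 1\<close>; the constant 3 absorbs the 1, as
  \<open>ln (x + 1) >= ln 2 >= 2 / 3\<close>.\<close>

lemma min_ratio_mult_ln_le:
  fixes s :: real
  assumes "s \<ge> 1" "x \<ge> (1 :: nat)"
  shows "min 1 (real x / s) * ln s \<le> 3 * ln (real x + 1)"
proof -
  have lnx: "ln (real x) \<le> ln (real x + 1)" "0 \<le> ln (real x)" using assms by auto
  have "2 / 3 \<le> ln (2 :: real)" by (rule ln2_ge_two_thirds)
  also have "\<dots> \<le> ln (real x + 1)" using assms by simp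
  finally have ln2: "2 / 3 \<le> ln (real x + 1)" .
  show ?thesis
  proof (cases "s \<le> real x")
    case True
    then have "min 1 (real x / s) = 1" using assms by simp
    moreover have "ln s \<le> ln (real x)" using True assms by simp
    ultimately show ?thesis using lnx by simp
  next
    case False
    have r: "0 < real x / s" "real x / s \<le> 1" using assms False by auto
    have "ln (s / real x) \<le> s / real x"
      using assms ln_le_minus_one[of "s / real x"] by simp
    then have "ln s \<le> ln (real x) + s / real x"
      using assms by (simp add: ln_div)
    then have "real x / s * ln s \<le> real x / s * (ln (real x) + s / real x)"
      using r by (intro mult_left_mono) auto
    also have "\<dots> = real x / s * ln (real x) + 1" using assms by (simp add: distrib_left)
    also have "\<dots> \<le> 1 * ln (real x) + 1" using r lnx by (intro add_mono mult_right_mono) auto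
    finally show ?thesis using r ln2 lnx by simp
  qed
qed

section \<open>The estimates for one mixed edge set\<close>

locale log_moment_communities = iid_communities +
  assumes moment: "integrable M (\<lambda>\<omega>. real (X 0 \<omega>) * h (X 0 \<omega>) (Q 0 \<omega>) * ln (real (X 0 \<omega>) + 1))"
    and nondegenerate: "(\<integral>\<omega>. Q 0 \<omega> * indicator {\<omega>. X 0 \<omega> \<ge> 2} \<omega> \<partial>M) > 0"
begin

definition W :: "'a \<Rightarrow> real" where
  "W \<omega> = real (X 0 \<omega>) * h (X 0 \<omega>) (Q 0 \<omega>)"

definition mean_W :: real where "mean_W = expectation W"

definition mean_Q :: real where
  "mean_Q = expectation (\<lambda>\<omega>. Q 0 \<omega> * indicator {\<omega>. X 0 \<omega> \<ge> 2} \<omega>)"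

text \<open>This is the error function \<open>e\<close>: the share of \<open>mean_W\<close> due to
  sizes of at least \<open>s\<close>, plus that of smaller sizes damped by \<open>X / s\<close>. The
  argument is real because it is also taken at \<open>n / k\<close>.\<close>

definition trunc_W :: "real \<Rightarrow> real" where
  "trunc_W s = expectation (\<lambda>\<omega>. W \<omega> * min 1 (real (X 0 \<omega>) / s))"

lemma h_measurable [measurable]: "(\<lambda>\<omega>. h (X 0 \<omega>) (Q 0 \<omega>)) \<in> borel_measurable M"
proof (rule measurable_compose_countable[where f = "\<lambda>x \<omega>. h x (Q 0 \<omega>)" and g = "X 0"])
  show "(\<lambda>\<omega>. h x (Q 0 \<omega>)) \<in> borel_measurable M" for x
    unfolding h_def by measurable
qed simp

lemma real_X_measurable [measurable]: "(\<lambda>\<omega>. real (X 0 \<omega>)) \<in> borel_measurable M"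
  by (rule measurable_compose[OF X_measurable]) simp

lemma W_measurable [measurable]: "W \<in> borel_measurable M"
  unfolding W_def by measurable

lemma W_nonneg: "\<omega> \<in> space M \<Longrightarrow> 0 \<le> W \<omega>"
  using h_bounds(1)[of "Q 0 \<omega>" "X 0 \<omega>"] Q_bounds[of \<omega> 0] by (simp add: W_def)

lemma moment_W: "integrable M (\<lambda>\<omega>. W \<omega> * ln (real (X 0 \<omega>) + 1))"
  using moment by (simp add: W_def)

text \<open>\<open>W\<close> vanishes at size 0, and for larger sizes the logarithm in the moment
  condition is at least \<open>ln 2\<close>, so that twice it exceeds 1.\<close>

lemma W_integrable: "integrable M W"
proof (rule Bochner_Integration.integrable_bound)
  show "integrable M (\<lambda>\<omega>. 2 * (W \<omega> * ln (real (X 0 \<omega>) + 1)))"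
    using moment_W by simp
  show "AE \<omega> in M. norm (W \<omega>) \<le> norm (2 * (W \<omega> * ln (real (X 0 \<omega>) + 1)))"
  proof (rule AE_I2)
    fix \<omega> assume w: "\<omega> \<in> space M"
    show "norm (W \<omega>) \<le> norm (2 * (W \<omega> * ln (real (X 0 \<omega>) + 1)))"
    proof (cases "X 0 \<omega> = 0")
      case False
      have "1 \<le> 2 * ln (2 :: real)" using ln2_ge_two_thirds by simp
      also have "\<dots> \<le> 2 * ln (real (X 0 \<omega>) + 1)" using False by simp
      finally have "W \<omega> * 1 \<le> W \<omega> * (2 * ln (real (X 0 \<omega>) + 1))"
        using W_nonneg[OF w] by (intro mult_left_mono) auto
      then show ?thesis using W_nonneg[OF w] by (simp add: abs_mult)
    qed (simp add: W_def)
  qed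
qed simp

lemma trunc_integrable:
  assumes "s > 0"
  shows "integrable M (\<lambda>\<omega>. W \<omega> * min 1 (real (X 0 \<omega>) / s))"
proof (rule Bochner_Integration.integrable_bound[OF W_integrable])
  show "AE \<omega> in M. norm (W \<omega> * min 1 (real (X 0 \<omega>) / s)) \<le> norm (W \<omega>)"
    using assms by (intro AE_I2) (auto simp: abs_mult intro!: mult_left_le)
qed measurable

lemma trunc_W_nonneg: "s > 0 \<Longrightarrow> 0 \<le> trunc_W s"
  unfolding trunc_W_def using W_nonneg
  by (intro integral_nonneg_AE AE_I2 mult_nonneg_nonneg) auto

lemma trunc_W_mult_ln_tendsto_0: "((\<lambda>s. trunc_W s * ln s) \<longlongrightarrow> 0) at_top"
proof -
  let ?f = "\<lambda>s \<omega>. W \<omega> * min 1 (real (X 0 \<omega>) / s) * ln s"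
  have "((\<lambda>s. \<integral>\<omega>. ?f s \<omega> \<partial>M) \<longlongrightarrow> (\<integral>\<omega>. 0 \<partial>M)) at_top"
  proof (rule integral_dominated_convergence_at_top)
    show "integrable M (\<lambda>\<omega>. 3 * (W \<omega> * ln (real (X 0 \<omega>) + 1)))"
      using moment_W by simp
    show "\<forall>\<^sub>F s in at_top. AE \<omega> in M. norm (?f s \<omega>) \<le> 3 * (W \<omega> * ln (real (X 0 \<omega>) + 1))"
    proof (rule eventually_mono[OF eventually_ge_at_top[of 1]], rule AE_I2)
      fix s :: real and \<omega> assume s: "1 \<le> s" and w: "\<omega> \<in> space M"
      show "norm (?f s \<omega>) \<le> 3 * (W \<omega> * ln (real (X 0 \<omega>) + 1))"
      proof (cases "X 0 \<omega> = 0")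
        case False
        have "0 \<le> min 1 (real (X 0 \<omega>) / s) * ln s" using s by simp
        then have "norm (?f s \<omega>) = W \<omega> * (min 1 (real (X 0 \<omega>) / s) * ln s)"
          using W_nonneg[OF w] s by (simp add: abs_mult)
        also have "\<dots> \<le> W \<omega> * (3 * ln (real (X 0 \<omega>) + 1))"
          using s False W_nonneg[OF w] by (intro mult_left_mono min_ratio_mult_ln_le) auto
        finally show ?thesis by simp
      qed (simp add: W_def)
    qed
    show "AE \<omega> in M. ((\<lambda>s. ?f s \<omega>) \<longlongrightarrow> 0) at_top"
    proof (rule AE_I2)
      fix \<omega> assume w: "\<omega> \<in> space M"
      have "((\<lambda>s. W \<omega> * real (X 0 \<omega>) * (ln s / s)) \<longlongrightarrow> W \<omega> * real (X 0 \<omega>) * 0) at_top"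
        by (intro tendsto_mult_left ln_x_over_x_tendsto_0)
      then have lim: "((\<lambda>s. W \<omega> * real (X 0 \<omega>) * (ln s / s)) \<longlongrightarrow> 0) at_top" by simp
      show "((\<lambda>s. ?f s \<omega>) \<longlongrightarrow> 0) at_top"
      proof (rule real_tendsto_sandwich[OF _ _ tendsto_const lim])
        show "\<forall>\<^sub>F s in at_top. 0 \<le> ?f s \<omega>"
          using W_nonneg[OF w] by (intro eventually_mono[OF eventually_ge_at_top[of 1]]) simp
        show "\<forall>\<^sub>F s in at_top. ?f s \<omega> \<le> W \<omega> * real (X 0 \<omega>) * (ln s / s)"
        proof (rule eventually_mono[OF eventually_ge_at_top[of 1]])
          fix s :: real assume s: "1 \<le> s"
          have "?f s \<omega> \<le> W \<omega> * (real (X 0 \<omega>) / s) * ln s"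
            using s W_nonneg[OF w] by (intro mult_right_mono mult_left_mono) auto
          then show "?f s \<omega> \<le> W \<omega> * real (X 0 \<omega>) * (ln s / s)" by simp
        qed
      qed
    qed
  qed measurable
  then show ?thesis by (simp add: trunc_W_def)
qed

lemma W_min_le:
  assumes "\<omega> \<in> space M"
  shows "real (min (X 0 \<omega>) n) * h (min (X 0 \<omega>) n) (Q 0 \<omega>) \<le> W \<omega>"
  unfolding W_def using Q_bounds[OF assms, of 0]
  by (intro mult_mono h_mono h_bounds) auto

lemma prob_edges_integrable:
  "integrable M (\<lambda>\<omega>. measure_pmf.prob (edges_pmf n (min (X i \<omega>) n) (Q i \<omega>)) A)"
  by (rule integrable_const_bound[where B = 1]) auto

lemma prob_mixed_edges_le:
  assumes "integrable M f"
    and "\<And>\<omega>. \<omega> \<in> space M \<Longrightarrow> measure_pmf.prob (edges_pmf n (min (X 0 \<omega>) n) (Q 0 \<omega>)) A \<le> f \<omega>"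
  shows "measure_pmf.prob (mixed_edges_pmf n) A \<le> expectation f"
  unfolding prob_mixed_edges using assms prob_edges_integrable
  by (intro integral_mono) auto

lemma prob_mixed_not_isolated:
  assumes "n \<ge> 1" "v \<in> {1..n}"
  shows "measure_pmf.prob (mixed_edges_pmf n) {E. \<not> isolated E v} \<le> mean_W / n"
proof -
  have "measure_pmf.prob (mixed_edges_pmf n) {E. \<not> isolated E v} \<le> expectation (\<lambda>\<omega>. W \<omega> / n)"
  proof (rule prob_mixed_edges_le)
    fix \<omega> assume w: "\<omega> \<in> space M"
    let ?x = "min (X 0 \<omega>) n"
    have "measure_pmf.prob (edges_pmf n ?x (Q 0 \<omega>)) {E. \<forall>u\<in>{v}. \<not> isolated E u}
       \<le> (real ?x / real n) ^ card {v} * h ?x (Q 0 \<omega>)"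
      using assms Q_bounds[OF w] by (intro prob_edges_not_isolated_all) auto
    also have "\<dots> = real ?x * h ?x (Q 0 \<omega>) / n" by simp
    also have "\<dots> \<le> W \<omega> / n"
      using W_min_le[OF w] by (intro divide_right_mono) auto
    finally show "measure_pmf.prob (edges_pmf n ?x (Q 0 \<omega>)) {E. \<not> isolated E v} \<le> W \<omega> / n" by simp
  qed (use W_integrable in simp)
  then show ?thesis by (simp add: mean_W_def)
qed

lemma prob_mixed_not_isolated_pair:
  assumes "u \<in> {1..n}" "v \<in> {1..n}" "u \<noteq> v"
  shows "measure_pmf.prob (mixed_edges_pmf n) {E. \<not> isolated E u \<and> \<not> isolated E v} \<le> trunc_W n / n"
proof -
  have n: "n > 0" using assms by simp
  have "measure_pmf.prob (mixed_edges_pmf n) {E. \<not> isolated E u \<and> \<not> isolated E v}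
    \<le> expectation (\<lambda>\<omega>. W \<omega> * min 1 (real (X 0 \<omega>) / n) / n)"
  proof (rule prob_mixed_edges_le)
    fix \<omega> assume w: "\<omega> \<in> space M"
    let ?x = "min (X 0 \<omega>) n"
    have "measure_pmf.prob (edges_pmf n ?x (Q 0 \<omega>)) {E. \<forall>u\<in>{u, v}. \<not> isolated E u}
       \<le> (real ?x / real n) ^ card {u, v} * h ?x (Q 0 \<omega>)"
      using assms Q_bounds[OF w] by (intro prob_edges_not_isolated_all) auto
    also have "\<dots> = real ?x * h ?x (Q 0 \<omega>) * (real ?x / n) / n"
      using assms(3) by (simp add: power2_eq_square)
    also have "\<dots> \<le> W \<omega> * (real ?x / n) / n"
      using W_min_le[OF w] by (intro divide_right_mono mult_right_mono) auto
    \<comment> \<open>Cutting the size off at \<open>n\<close> is the same as the truncation in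
      \<open>trunc_W\<close> at \<open>s = n\<close>.\<close>
    also have "real ?x / n = min 1 (real (X 0 \<omega>) / n)"
      using n by (simp add: min_def)
    finally show "measure_pmf.prob (edges_pmf n ?x (Q 0 \<omega>)) {E. \<not> isolated E u \<and> \<not> isolated E v}
      \<le> W \<omega> * min 1 (real (X 0 \<omega>) / n) / n" by simp
  qed (use trunc_integrable[of n] n in simp)
  then show ?thesis by (simp add: trunc_W_def)
qed

lemma prob_mixed_separated_le:
  assumes "S \<subseteq> {1..n}" "n \<ge> 1" "integrable M f"
    and "\<And>\<omega> x t. \<omega> \<in> space M \<Longrightarrow> x = min (X 0 \<omega>) n \<Longrightarrow> t = real (card S) / real n \<Longrightarrow>
      f \<omega> \<le> h x (Q 0 \<omega>) * (1 - (1 - t) ^ x - t ^ x)"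
  shows "measure_pmf.prob (mixed_edges_pmf n) {E. separated E S} \<le> 1 - expectation f"
proof -
  have "measure_pmf.prob (mixed_edges_pmf n) {E. separated E S} \<le> expectation (\<lambda>\<omega>. 1 - f \<omega>)"
  proof (rule prob_mixed_edges_le)
    fix \<omega> assume w: "\<omega> \<in> space M"
    let ?x = "min (X 0 \<omega>) n" and ?t = "real (card S) / real n"
    have "measure_pmf.prob (edges_pmf n ?x (Q 0 \<omega>)) {E. separated E S}
      \<le> 1 - h ?x (Q 0 \<omega>) * (1 - (1 - ?t) ^ ?x - ?t ^ ?x)"
      using assms Q_bounds[OF w] by (intro prob_edges_separated) auto
    also have "\<dots> \<le> 1 - f \<omega>" using assms(4)[OF w refl refl] by simp
    finally show "measure_pmf.prob (edges_pmf n ?x (Q 0 \<omega>)) {E. separated E S} \<le> 1 - f \<omega>" .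
  qed (use assms in simp)
  also have "expectation (\<lambda>\<omega>. 1 - f \<omega>) = 1 - expectation f"
    using assms(3) by (simp add: prob_space)
  finally show ?thesis .
qed

text \<open>The first bound has the sharp constant but is empty when
  \<open>trunc_W (n / card S)\<close> reaches \<open>mean_W\<close>, which can happen for sets of
  linear size. The second has a poorer constant that is positive for every set size.\<close>

lemma prob_mixed_separated:
  assumes "S \<subseteq> {1..n}" "S \<noteq> {}" "2 * card S \<le> n"
  shows "measure_pmf.prob (mixed_edges_pmf n) {E. separated E S}
      \<le> 1 - card S / n * (mean_W - trunc_W (n / card S))"
    and "measure_pmf.prob (mixed_edges_pmf n) {E. separated E S} \<le> 1 - card S / n * mean_Q"
proof -
  define t where "t = real (card S) / real n"
  have fin: "finite S" using assms finite_subset by auto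
  then have k: "card S \<ge> 1" using assms by (simp add: Suc_le_eq card_gt_0_iff)
  then have n: "n \<ge> 2" using assms by linarith
  have "2 * real (card S) \<le> real n" using assms(3) by linarith
  then have t: "0 < t" "t \<le> 1 / 2" using k n by (auto simp: t_def divide_simps)
  have s: "real n / real (card S) > 0" using k n by simp
  have Xs: "real x / (real n / real (card S)) = real x * t" for x
    using k n by (simp add: t_def)
  have "measure_pmf.prob (mixed_edges_pmf n) {E. separated E S}
    \<le> 1 - expectation (\<lambda>\<omega>. t * (W \<omega> - W \<omega> * min 1 (real (X 0 \<omega>) / (n / card S))))"
  proof (rule prob_mixed_separated_le)
    fix \<omega> x t' assume w: "\<omega> \<in> space M" and x: "x = min (X 0 \<omega>) n" and t': "t' = real (card S) / real n"
    have t'_eq: "t' = t" by (simp add: t' t_def)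
    have hx: "0 \<le> h x (Q 0 \<omega>)" using Q_bounds[OF w] by (intro h_bounds) auto
    show "t * (W \<omega> - W \<omega> * min 1 (real (X 0 \<omega>) / (n / card S)))
      \<le> h x (Q 0 \<omega>) * (1 - (1 - t') ^ x - t' ^ x)"
    proof (cases "x \<le> 1")
      case True
      then have "X 0 \<omega> \<le> 1" using n unfolding x by linarith
      then show ?thesis using h_eq_0 True by (simp add: W_def)
    next
      case x2: False
      show ?thesis
      \<comment> \<open>Where \<open>X * t >= 1\<close> the truncation equals 1, the claimed lower
        bound is 0, and nonnegativity of the splitting probability is enough.\<close>
      proof (cases "real (X 0 \<omega>) * t \<ge> 1")
        case True
        then have "min 1 (real (X 0 \<omega>) / (n / card S)) = 1" unfolding Xs by simp
        moreover have "0 \<le> h x (Q 0 \<omega>) * (1 - (1 - t') ^ x - t' ^ x)"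
          using hx t x2 unfolding t'_eq by (intro mult_nonneg_nonneg split_prob_nonneg) auto
        ultimately show ?thesis by simp
      next
        case False
        \<comment> \<open>Since \<open>n * t = card S\<close> is at least 1,
          \<open>X * t < 1\<close> forces \<open>X < n\<close>: the cut-off at \<open>n\<close> is
          inactive exactly where the sharp bound is applied.\<close>
        have "X 0 \<omega> < n"
        proof (rule ccontr)
          assume "\<not> X 0 \<omega> < n"
          then have "real n * t \<le> real (X 0 \<omega>) * t" using t by (intro mult_right_mono) auto
          moreover have "real n * t \<ge> 1" using k n by (simp add: t_def)
          ultimately show False using False by linarith
        qed
        then have xX: "x = X 0 \<omega>" by (simp add: x)
        have "t * (W \<omega> - W \<omega> * min 1 (real (X 0 \<omega>) / (n / card S)))
          = h x (Q 0 \<omega>) * (real x * t * (1 - real x * t))"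
          using False unfolding Xs by (simp add: W_def xX algebra_simps)
        also have "\<dots> \<le> h x (Q 0 \<omega>) * (1 - (1 - t') ^ x - t' ^ x)"
          unfolding t'_eq using hx t x2 by (intro mult_left_mono split_prob_ge) auto
        finally show ?thesis .
      qed
    qed
  qed (use assms n s W_integrable trunc_integrable[of "n / card S"] in auto)
  also have "expectation (\<lambda>\<omega>. t * (W \<omega> - W \<omega> * min 1 (real (X 0 \<omega>) / (n / card S))))
    = t * (mean_W - trunc_W (n / card S))"
    using W_integrable trunc_integrable[OF s] by (simp add: mean_W_def trunc_W_def)
  finally show "measure_pmf.prob (mixed_edges_pmf n) {E. separated E S}
      \<le> 1 - card S / n * (mean_W - trunc_W (n / card S))" by (simp add: t_def)
  let ?Q = "\<lambda>\<omega>. Q 0 \<omega> * indicator {\<omega>. X 0 \<omega> \<ge> 2} \<omega>"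
  have "measure_pmf.prob (mixed_edges_pmf n) {E. separated E S} \<le> 1 - expectation (\<lambda>\<omega>. t * ?Q \<omega>)"
  proof (rule prob_mixed_separated_le)
    have [measurable]: "?Q \<in> borel_measurable M"
    proof -
      have "?Q = (\<lambda>\<omega>. if 2 \<le> X 0 \<omega> then Q 0 \<omega> else 0)" by (auto simp: indicator_def)
      then show ?thesis by simp
    qed
    show "integrable M (\<lambda>\<omega>. t * ?Q \<omega>)"
      using t Q_bounds[of _ 0]
      by (intro integrable_mult_right integrable_const_bound[where B = 1] AE_I2) (auto simp: indicator_def)
    fix \<omega> x t' assume w: "\<omega> \<in> space M" and x: "x = min (X 0 \<omega>) n" and t': "t' = real (card S) / real n"
    have t'_eq: "t' = t" by (simp add: t' t_def)
    have hx: "0 \<le> h x (Q 0 \<omega>)" using Q_bounds[OF w] by (intro h_bounds) auto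
    show "t * ?Q \<omega> \<le> h x (Q 0 \<omega>) * (1 - (1 - t') ^ x - t' ^ x)"
    proof (cases "X 0 \<omega> \<ge> 2")
      case True
      then have "x \<ge> 2" using n x by simp
      then have "Q 0 \<omega> * t \<le> h x (Q 0 \<omega>) * (1 - (1 - t') ^ x - t' ^ x)"
        unfolding t'_eq using t Q_bounds[OF w] hx
        by (intro mult_mono h_ge split_prob_ge_linear) auto
      then show ?thesis using True by (simp add: mult.commute)
    next
      case False
      then show ?thesis using h_eq_0[of x] x by simp
    qed
  qed (use assms n in auto)
  then show "measure_pmf.prob (mixed_edges_pmf n) {E. separated E S} \<le> 1 - card S / n * mean_Q"
    by (simp add: mean_Q_def t_def)
qed

lemma mean_Q_pos: "mean_Q > 0"
  using nondegenerate by (simp add: mean_Q_def)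

lemma mean_W_pos: "mean_W > 0"
proof -
  have "mean_Q \<le> mean_W"
    unfolding mean_Q_def mean_W_def
  proof (rule integral_mono_AE')
    show "AE \<omega> in M. Q 0 \<omega> * indicator {\<omega>. X 0 \<omega> \<ge> 2} \<omega> \<le> W \<omega>"
    proof (rule AE_I2)
      fix \<omega> assume w: "\<omega> \<in> space M"
      show "Q 0 \<omega> * indicator {\<omega>. X 0 \<omega> \<ge> 2} \<omega> \<le> W \<omega>"
      proof (cases "X 0 \<omega> \<ge> 2")
        case True
        have "1 * Q 0 \<omega> \<le> W \<omega>"
          unfolding W_def using True Q_bounds[OF w, of 0] by (intro mult_mono h_ge) auto
        then show ?thesis using True by simp
      qed (use W_nonneg[OF w] in simp)
    qed
  qed (use W_integrable W_nonneg Q_bounds[of _ 0] in \<open>auto intro!: AE_I2\<close>)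
  then show ?thesis using mean_Q_pos by simp
qed

end

section \<open>Unions of independent edge sets\<close>

lemma ln_nat_at_top: "filterlim (\<lambda>n. ln (real n)) at_top sequentially"
  by (rule filterlim_compose[OF ln_at_top filterlim_real_sequentially])

lemma power_le_exp_minus:
  fixes q p :: real
  assumes "0 \<le> q" "q \<le> 1 - p"
  shows "q ^ m \<le> exp (- (real m * p))"
proof -
  have "q \<le> exp (- p)" using assms exp_ge_add_one_self[of "- p"] by simp
  then have "q ^ m \<le> exp (- p) ^ m" using assms by (intro power_mono) auto
  then show ?thesis by (simp add: exp_of_nat_mult[symmetric])
qed

lemma sum_power_le:
  fixes b :: real
  assumes "0 \<le> b" "b \<le> 1 / 2"
  shows "(\<Sum>k\<in>{K..N}. b ^ k) \<le> 2 * b ^ K"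
proof (cases "N < K")
  case False
  have "(\<Sum>k\<in>{K..N}. b ^ k) = (b ^ K - b ^ Suc N) / (1 - b)"
    using assms False by (subst sum_gp) auto
  also have "\<dots> \<le> b ^ K / (1 / 2)"
    using assms by (intro frac_le) auto
  finally show ?thesis by simp
qed (use assms in simp)

lemma power_div_fact_le_exp:
  fixes x :: real
  assumes "x \<ge> 0"
  shows "x ^ k / fact k \<le> exp x"
proof -
  have "sum (\<lambda>n. x ^ n /\<^sub>R fact n) {k} \<le> (\<Sum>n. x ^ n /\<^sub>R fact n)"
    using assms by (intro sum_le_suminf sums_summable[OF exp_converges]) auto
  also have "\<dots> = exp x" by (rule sums_unique[OF exp_converges, symmetric])
  finally show ?thesis by (simp add: divide_inverse mult.commute)
qed

text \<open>The familiar bound \<open>(e n / k) ^ k\<close>, where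
  \<open>k ^ k / k! <= exp k\<close> because it is one term of the series. The exponential form lets
  it merge with the decay of the cut probability.\<close>

lemma choose_le_exp:
  assumes "n \<ge> 1" "k \<ge> 1"
  shows "real (n choose k) \<le> exp (real k * (ln n + 1 - ln k))"
proof -
  have "real (n choose k) * fact k \<le> real n ^ k"
    using binomial_fact_pow[of n k] by (metis of_nat_fact of_nat_le_iff of_nat_mult of_nat_power)
  moreover have "real k ^ k \<le> exp (real k) * fact k"
    using power_div_fact_le_exp[of "real k" k] by (simp add: divide_simps)
  ultimately have "(real (n choose k) * fact k) * real k ^ k \<le> real n ^ k * (exp (real k) * fact k)"
    by (intro mult_mono) auto
  then have "real (n choose k) * real k ^ k \<le> real n ^ k * exp (real k)"
    by (simp add: mult_ac)
  then have "real (n choose k) \<le> real n ^ k * exp (real k) / real k ^ k"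
    using assms by (simp add: field_simps)
  also have "\<dots> = exp (real k * (ln n + 1 - ln k))"
    using assms by (simp add: right_diff_distrib distrib_left exp_diff exp_add exp_of_nat_mult)
  finally show ?thesis .
qed

lemma choose_div_power_tendsto:
  "(\<lambda>n. real (n choose r) / real n ^ r) \<longlonglongrightarrow> 1 / fact r"
proof (induction r)
  case (Suc r)
  have "(\<lambda>n. 1 - real r / real n) \<longlonglongrightarrow> 1 - 0"
    by (intro tendsto_diff tendsto_const lim_const_over_n)
  then have A: "(\<lambda>n. real (n choose r) / real n ^ r * (1 - real r / real n) / real (Suc r))
      \<longlonglongrightarrow> 1 / fact r * (1 - 0) / real (Suc r)"
    by (intro tendsto_divide[OF tendsto_mult[OF Suc] tendsto_const]) auto
  have B: "1 / fact r * (1 - 0) / real (Suc r) = 1 / (fact (Suc r) :: real)"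
    by (simp add: field_simps)
  have C: "\<forall>\<^sub>F n in sequentially. real (n choose r) / real n ^ r * (1 - real r / real n) / real (Suc r)
      = real (n choose Suc r) / real n ^ Suc r"
  proof (rule eventually_mono[OF eventually_ge_at_top[of "Suc r"]])
    fix n assume n: "Suc r \<le> n"
    have "Suc r * (n choose Suc r) = (n - r) * (n choose r)"
      by (simp only: binomial_absorption binomial_absorb_comp)
    then have "real (Suc r) * real (n choose Suc r) = real (n - r) * real (n choose r)"
      by (metis of_nat_mult)
    then have eq: "real (n choose Suc r) = (real n - real r) * real (n choose r) / real (Suc r)"
      using n by (simp add: of_nat_diff field_simps)
    show "real (n choose r) / real n ^ r * (1 - real r / real n) / real (Suc r)
      = real (n choose Suc r) / real n ^ Suc r"
      unfolding eq using n by (simp add: divide_simps)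
  qed
  show ?case using Lim_transform_eventually[OF A C] unfolding B .
qed simp

lemma alternating_choose_sum:
  "(\<Sum>r\<le>R. (-1) ^ r * real (Suc N choose r)) = (-1) ^ R * real (N choose R)"
  by (induction R) (simp_all add: algebra_simps)

text \<open>For positive \<open>N\<close> and \<open>R\<close> the alternating sum telescopes, by
  Pascal's rule, to \<open>N - 1 choose R - 1\<close> up to sign, and this is at most
  \<open>N choose R\<close>. A two-sided error is sufficient, so the parity of \<open>R\<close> is
  immaterial.\<close>

lemma bonferroni_choose:
  "\<bar>of_bool (N = 0) - (\<Sum>r<R. (-1) ^ r * real (N choose r))\<bar> \<le> real (N choose R)"
proof (cases R)
  case (Suc R')
  show ?thesis
  proof (cases N)
    case 0
    have "(\<Sum>r<R. (-1) ^ r * real (N choose r)) = (\<Sum>r\<in>{0}. (-1) ^ r * real (N choose r))"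
      unfolding 0 Suc by (rule sum.mono_neutral_right) (auto simp: binomial_eq_0_iff)
    then show ?thesis using 0 by simp
  next
    case (Suc N')
    then show ?thesis
      using alternating_choose_sum[of N' R'] \<open>R = Suc R'\<close>
      by (simp add: lessThan_Suc_atMost abs_mult power_abs)
  qed
qed simp

lemma (in prob_space) prob_Un_le_sum:
  assumes "finite I" "\<And>i. i \<in> I \<Longrightarrow> A i \<in> events" "B \<in> events" "B \<subseteq> (\<Union>i\<in>I. A i)"
  shows "prob B \<le> (\<Sum>i\<in>I. prob (A i))"
proof -
  have "prob B \<le> prob (\<Union>i\<in>I. A i)"
    using assms by (intro finite_measure_mono) auto
  also have "\<dots> \<le> (\<Sum>i\<in>I. prob (A i))"
    using assms by (intro finite_measure_subadditive_finite) auto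
  finally show ?thesis .
qed

lemma prob_pmf_le_sum:
  assumes "finite I" "\<And>x. x \<in> set_pmf p \<Longrightarrow> x \<in> B \<Longrightarrow> \<exists>i\<in>I. x \<in> A i"
  shows "measure_pmf.prob p B \<le> (\<Sum>i\<in>I. measure_pmf.prob p (A i))"
proof -
  have "measure_pmf.prob p B = measure_pmf.prob p (B \<inter> set_pmf p)"
    by (simp add: measure_Int_set_pmf)
  also have "\<dots> \<le> (\<Sum>i\<in>I. measure_pmf.prob p (A i))"
    using assms by (intro measure_pmf.prob_Un_le_sum) auto
  finally show ?thesis .
qed

lemma prob_pmf_not: "measure_pmf.prob p {x. \<not> P x} = 1 - measure_pmf.prob p {x. P x}"
  using measure_pmf.prob_compl[of "{x. P x}" p] by (simp add: set_diff_eq)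

section \<open>Events about a union of independent copies\<close>

definition union_pmf :: "'b set pmf \<Rightarrow> nat \<Rightarrow> 'b set pmf" where
  "union_pmf D m = map_pmf (\<lambda>E. \<Union>i\<in>{1..m}. E i) (Pi_pmf {1..m} {} (\<lambda>_. D))"

text \<open>Isolation and separation both restrict each edge individually, so they hold for a union
  iff they hold for every part.\<close>

lemma prob_union_pmf_all:
  "measure_pmf.prob (union_pmf D m) {E. \<forall>x\<in>E. R x} = measure_pmf.prob D {E. \<forall>x\<in>E. R x} ^ m"
proof -
  have "measure_pmf.prob (union_pmf D m) {E. \<forall>x\<in>E. R x}
    = measure_pmf.prob (Pi_pmf {1..m} {} (\<lambda>_. D)) (Pi {1..m} (\<lambda>_. {E. \<forall>x\<in>E. R x}))"
    unfolding union_pmf_def measure_map_pmf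
    by (rule arg_cong[where f = "measure_pmf.prob _"]) (auto simp: Pi_def)
  then show ?thesis by (simp add: measure_Pi_pmf_Pi)
qed

text \<open>Union bound over the draw that contributes the element with \<open>T\<close>. That draw
  gives up the constraint \<open>R\<close>, the other \<open>m - 1\<close> keep it.\<close>

lemma prob_union_pmf_all_ex:
  "measure_pmf.prob (union_pmf D m) {E. (\<forall>x\<in>E. R x) \<and> (\<exists>x\<in>E. T x)}
    \<le> real m * measure_pmf.prob D {E. \<exists>x\<in>E. T x} * measure_pmf.prob D {E. \<forall>x\<in>E. R x} ^ (m - 1)"
proof -
  let ?B = "\<lambda>i j. if j = i then {E. \<exists>x\<in>E. T x} else {E. \<forall>x\<in>E. R x}"
  let ?p = "Pi_pmf {1..m} {} (\<lambda>_. D)"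
  have "measure_pmf.prob (union_pmf D m) {E. (\<forall>x\<in>E. R x) \<and> (\<exists>x\<in>E. T x)}
    = measure_pmf.prob ?p ((\<lambda>E. \<Union>i\<in>{1..m}. E i) -` {E. (\<forall>x\<in>E. R x) \<and> (\<exists>x\<in>E. T x)})"
    unfolding union_pmf_def by (rule measure_map_pmf)
  also have "\<dots> \<le> (\<Sum>i\<in>{1..m}. measure_pmf.prob ?p (Pi {1..m} (?B i)))"
  proof (rule prob_pmf_le_sum)
    fix E assume "E \<in> (\<lambda>E. \<Union>i\<in>{1..m}. E i) -` {E. (\<forall>x\<in>E. R x) \<and> (\<exists>x\<in>E. T x)}"
    then obtain i x where "i \<in> {1..m}" "x \<in> E i" "T x" "\<forall>i\<in>{1..m}. \<forall>x\<in>E i. R x" by auto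
    then show "\<exists>i\<in>{1..m}. E \<in> Pi {1..m} (?B i)" by (intro bexI[of _ i]) auto
  qed simp
  also have "\<dots> = (\<Sum>i\<in>{1..m}. measure_pmf.prob D {E. \<exists>x\<in>E. T x} * measure_pmf.prob D {E. \<forall>x\<in>E. R x} ^ (m - 1))"
  proof (rule sum.cong[OF refl])
    fix i assume i: "i \<in> {1..m}"
    have "measure_pmf.prob ?p (Pi {1..m} (?B i)) = (\<Prod>j\<in>{1..m}. measure_pmf.prob D (?B i j))"
      by (rule measure_Pi_pmf_Pi) simp
    also have "\<dots> = measure_pmf.prob D (?B i i) * (\<Prod>j\<in>{1..m} - {i}. measure_pmf.prob D (?B i j))"
      using i by (intro prod.remove) auto
    also have "(\<Prod>j\<in>{1..m} - {i}. measure_pmf.prob D (?B i j))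
      = (\<Prod>j\<in>{1..m} - {i}. measure_pmf.prob D {E. \<forall>x\<in>E. R x})"
      by (rule prod.cong) auto
    also have "\<dots> = measure_pmf.prob D {E. \<forall>x\<in>E. R x} ^ (m - 1)" using i by simp
    finally show "measure_pmf.prob ?p (Pi {1..m} (?B i))
      = measure_pmf.prob D {E. \<exists>x\<in>E. T x} * measure_pmf.prob D {E. \<forall>x\<in>E. R x} ^ (m - 1)" by simp
  qed
  finally show ?thesis by simp
qed

lemma set_union_pmf:
  assumes "set_pmf D \<subseteq> Pow V"
  shows "set_pmf (union_pmf D m) \<subseteq> Pow V"
proof
  fix U assume "U \<in> set_pmf (union_pmf D m)"
  then obtain E where E: "E \<in> set_pmf (Pi_pmf {1..m} {} (\<lambda>_. D))" "U = (\<Union>i\<in>{1..m}. E i)"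
    by (auto simp: union_pmf_def)
  have "E \<in> PiE_dflt {1..m} {} (set_pmf \<circ> (\<lambda>_. D))"
    using E(1) set_Pi_pmf_subset'[of "{1..m}" "{}" "\<lambda>_. D"] by blast
  then have "E i \<in> set_pmf D" if "i \<in> {1..m}" for i
    using that unfolding PiE_dflt_def o_def by blast
  then show "U \<in> Pow V" using assms unfolding E(2) by blast
qed

lemma integrable_bounded_pmf:
  fixes f :: "'b \<Rightarrow> real"
  assumes "\<And>x. \<bar>f x\<bar> \<le> C"
  shows "integrable (measure_pmf p) f"
  using assms by (intro measure_pmf.integrable_const_bound[where B = C] AE_I2) auto

text \<open>The interface between probability and asymptotics: \<open>\<kappa>\<close>,
  \<open>\<mu>\<close> and \<open>e\<close> stand for \<open>mean_W\<close>, \<open>mean_Q\<close>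
  and \<open>trunc_W\<close>. There is no lower bound on the chance that a vertex is touched, since
  \<open>separated_local\<close> for singletons contains it.\<close>

locale sparse_edge_law =
  fixes D :: "nat \<Rightarrow> nat set set pmf" and \<kappa> \<mu> :: real and e :: "real \<Rightarrow> real"
  assumes kappa_pos: "0 < \<kappa>" and mu_pos: "0 < \<mu>"
    and e_nonneg: "\<And>s. s > 0 \<Longrightarrow> 0 \<le> e s"
    and e_ln_tendsto: "((\<lambda>s. e s * ln s) \<longlongrightarrow> 0) at_top"
    and edges: "\<And>n. set_pmf (D n) \<subseteq> Pow (pairs {1..n})"
    and not_isolated: "\<And>n v. v \<in> {1..n} \<Longrightarrow> measure_pmf.prob (D n) {E. \<not> isolated E v} \<le> \<kappa> / n"
    and not_isolated_pair: "\<And>n u v. u \<in> {1..n} \<Longrightarrow> v \<in> {1..n} \<Longrightarrow> u \<noteq> v \<Longrightarrow>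
      measure_pmf.prob (D n) {E. \<not> isolated E u \<and> \<not> isolated E v} \<le> e n / n"
    and separated_local: "\<And>n S. S \<subseteq> {1..n} \<Longrightarrow> S \<noteq> {} \<Longrightarrow> 2 * card S \<le> n \<Longrightarrow>
      measure_pmf.prob (D n) {E. separated E S} \<le> 1 - card S / n * (\<kappa> - e (n / card S))"
    and separated_global: "\<And>n S. S \<subseteq> {1..n} \<Longrightarrow> S \<noteq> {} \<Longrightarrow> 2 * card S \<le> n \<Longrightarrow>
      measure_pmf.prob (D n) {E. separated E S} \<le> 1 - card S / n * \<mu>"
begin

definition G :: "nat \<Rightarrow> nat \<Rightarrow> nat set set pmf" where
  "G n m = union_pmf (D n) m"

definition conn :: "nat \<Rightarrow> nat \<Rightarrow> real" where
  "conn n m = measure_pmf.prob (G n m) {E. connected_graph ({1..n}, E)}"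

definition no_isolated :: "nat \<Rightarrow> nat \<Rightarrow> real" where
  "no_isolated n m = measure_pmf.prob (G n m) {E. \<forall>v\<in>{1..n}. \<not> isolated E v}"

definition subsets :: "nat \<Rightarrow> nat \<Rightarrow> nat set set" where
  "subsets n k = {S. S \<subseteq> {1..n} \<and> card S = k}"

definition binomial_moment :: "nat \<Rightarrow> nat \<Rightarrow> nat \<Rightarrow> real" where
  "binomial_moment n m r = (\<Sum>S\<in>subsets n r. measure_pmf.prob (G n m) {E. \<forall>v\<in>S. isolated E v})"

definition count_isolated :: "nat \<Rightarrow> nat set set \<Rightarrow> nat" where
  "count_isolated n E = card {v\<in>{1..n}. isolated E v}"

lemma finite_subsets [simp]: "finite (subsets n k)"
  unfolding subsets_def by (rule finite_subset[of _ "Pow {1..n}"]) auto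

lemma card_subsets [simp]: "card (subsets n k) = n choose k"
  unfolding subsets_def using n_subsets[of "{1..n}" k] by simp

lemma set_G: "set_pmf (G n m) \<subseteq> Pow (pairs {1..n})"
  unfolding G_def by (intro set_union_pmf edges)

lemma prob_isolated_ge:
  assumes "n \<ge> 2" "v \<in> {1..n}"
  shows "(\<kappa> - e n) / n \<le> measure_pmf.prob (D n) {E. \<not> isolated E v}"
proof -
  have "measure_pmf.prob (D n) {E. isolated E v} = measure_pmf.prob (D n) {E. separated E {v}}"
  proof (intro measure_eq_AE)
    show "AE E in measure_pmf (D n). E \<in> {E. isolated E v} \<longleftrightarrow> E \<in> {E. separated E {v}}"
      unfolding AE_measure_pmf_iff
    proof
      fix E assume "E \<in> set_pmf (D n)"
      then have "E \<subseteq> pairs {1..n}" using edges by blast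
      then show "E \<in> {E. isolated E v} \<longleftrightarrow> E \<in> {E. separated E {v}}"
        by (simp only: mem_Collect_eq separated_singleton_iff_isolated)
    qed
  qed auto
  also have "\<dots> \<le> 1 - (\<kappa> - e n) / n"
    using separated_local[of "{v}" n] assms by simp
  finally have "measure_pmf.prob (D n) {E. isolated E v} \<le> 1 - (\<kappa> - e n) / n" .
  then show ?thesis unfolding prob_pmf_not by simp
qed

lemma prob_all_isolated_ge:
  assumes "S \<subseteq> {1..n}"
  shows "1 - card S * \<kappa> / n \<le> measure_pmf.prob (D n) {E. \<forall>v\<in>S. isolated E v}"
proof -
  have fin: "finite S" using assms finite_subset by auto
  have "measure_pmf.prob (D n) {E. \<not> (\<forall>v\<in>S. isolated E v)}
    \<le> (\<Sum>v\<in>S. measure_pmf.prob (D n) {E. \<not> isolated E v})"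
    using fin by (intro prob_pmf_le_sum) auto
  also have "\<dots> \<le> (\<Sum>v\<in>S. \<kappa> / n)"
    using assms by (intro sum_mono not_isolated) auto
  finally have "measure_pmf.prob (D n) {E. \<not> (\<forall>v\<in>S. isolated E v)} \<le> card S * \<kappa> / n" by simp
  then show ?thesis unfolding prob_pmf_not by simp
qed

text \<open>Adding \<open>w\<close> to \<open>S\<close> removes the event that \<open>w\<close> is
  touched and no vertex of \<open>S\<close> is. Its probability is at least
  \<open>(\<kappa> - e n) / n\<close> minus one pair probability for each element of
  \<open>S\<close>.\<close>

lemma prob_all_isolated_le:
  assumes "finite S" "S \<subseteq> {1..n}" "n \<ge> 2"
  shows "measure_pmf.prob (D n) {E. \<forall>v\<in>S. isolated E v}
    \<le> 1 - (card S * \<kappa> - (card S)\<^sup>2 * e n) / n"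
  using assms(1,2)
proof (induction S rule: finite_induct)
  case (insert w S)
  let ?P = "measure_pmf.prob (D n)"
  let ?A = "{E. \<forall>v\<in>S. isolated E v}"
  have w: "w \<in> {1..n}" and S: "S \<subseteq> {1..n}" using insert.prems by auto
  have "?P {E. \<not> isolated E w} \<le> ?P ((?A \<inter> {E. \<not> isolated E w}) \<union> (\<Union>v\<in>S. {E. \<not> isolated E w \<and> \<not> isolated E v}))"
    by (intro measure_pmf.finite_measure_mono) auto
  also have "\<dots> \<le> ?P (?A \<inter> {E. \<not> isolated E w}) + ?P (\<Union>v\<in>S. {E. \<not> isolated E w \<and> \<not> isolated E v})"
    by (intro measure_Un_le) auto
  also have "?P (\<Union>v\<in>S. {E. \<not> isolated E w \<and> \<not> isolated E v})
      \<le> (\<Sum>v\<in>S. ?P {E. \<not> isolated E w \<and> \<not> isolated E v})"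
    using insert by (intro prob_pmf_le_sum) auto
  also have "\<dots> \<le> (\<Sum>v\<in>S. e n / n)"
    using insert w S by (intro sum_mono not_isolated_pair) auto
  finally have 1: "(\<kappa> - e n) / n - card S * (e n / n) \<le> ?P (?A \<inter> {E. \<not> isolated E w})"
    using prob_isolated_ge[OF assms(3) w] by simp
  have "?P ?A = ?P ((?A \<inter> {E. \<not> isolated E w}) \<union> {E. \<forall>v\<in>insert w S. isolated E v})"
    by (rule arg_cong[where f = ?P]) auto
  also have "\<dots> = ?P (?A \<inter> {E. \<not> isolated E w}) + ?P {E. \<forall>v\<in>insert w S. isolated E v}"
    by (intro measure_pmf.finite_measure_Union) auto
  finally have "?P {E. \<forall>v\<in>insert w S. isolated E v} = ?P ?A - ?P (?A \<inter> {E. \<not> isolated E w})" by simp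
  also have "\<dots> \<le> (1 - (card S * \<kappa> - (card S)\<^sup>2 * e n) / n) - ((\<kappa> - e n) / n - card S * (e n / n))"
    using insert.IH[OF S] 1 by linarith
  also have "\<dots> = 1 - ((card S + 1) * \<kappa> - ((card S)\<^sup>2 + card S + 1) * e n) / n"
    by (simp add: diff_divide_distrib add_divide_distrib algebra_simps)
  \<comment> \<open>\<open>s^2 + s + 1 <= (s + 1)^2\<close> restores the form of the induction
    hypothesis.\<close>
  also have "\<dots> \<le> 1 - ((card S + 1) * \<kappa> - (card S + 1)\<^sup>2 * e n) / n"
  proof -
    have "((real (card S))\<^sup>2 + card S + 1) * e n \<le> (real (card S) + 1)\<^sup>2 * e n"
      using e_nonneg[of n] assms(3) by (intro mult_right_mono) (auto simp: power2_eq_square algebra_simps)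
    then show ?thesis
      using assms(3) by (auto intro!: divide_right_mono simp: add_ac)
  qed
  finally show ?case using insert by simp
qed simp

lemma prob_G_all_isolated:
  "measure_pmf.prob (G n m) {E. \<forall>v\<in>S. isolated E v} = measure_pmf.prob (D n) {E. \<forall>v\<in>S. isolated E v} ^ m"
proof -
  have "{E. \<forall>v\<in>S. isolated E v} = {E. \<forall>x\<in>E. \<forall>v\<in>S. v \<notin> x}" by (auto simp: isolated_def)
  then show ?thesis using prob_union_pmf_all[of "D n" m "\<lambda>x. \<forall>v\<in>S. v \<notin> x"] by (simp add: G_def)
qed

lemma prob_G_separated:
  "measure_pmf.prob (G n m) {E. separated E S} = measure_pmf.prob (D n) {E. separated E S} ^ m"
  using prob_union_pmf_all[of "D n" m "\<lambda>x. x \<subseteq> S \<or> x \<inter> S = {}"] by (simp add: G_def separated_def)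

lemma count_isolated_le: "count_isolated n E \<le> n"
proof -
  have "card {v\<in>{1..n}. isolated E v} \<le> card {1..n}" by (intro card_mono) auto
  then show ?thesis by (simp add: count_isolated_def)
qed

lemma count_isolated_eq_0_iff: "count_isolated n E = 0 \<longleftrightarrow> (\<forall>v\<in>{1..n}. \<not> isolated E v)"
  unfolding count_isolated_def by auto

lemma choose_count_integrable: "integrable (measure_pmf p) (\<lambda>E. real (count_isolated n E choose r))"
proof (rule integrable_bounded_pmf)
  fix E
  have "count_isolated n E choose r \<le> n choose r"
    using count_isolated_le by (rule binomial_right_mono)
  then show "\<bar>real (count_isolated n E choose r)\<bar> \<le> real (n choose r)" by simp
qed

lemma binomial_moment_eq:
  "measure_pmf.expectation (G n m) (\<lambda>E. real (count_isolated n E choose r)) = binomial_moment n m r"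
proof -
  have "real (count_isolated n E choose r)
      = (\<Sum>S\<in>subsets n r. indicator {E. \<forall>v\<in>S. isolated E v} E)" for E
  proof -
    let ?I = "{v\<in>{1..n}. isolated E v}"
    have "count_isolated n E choose r = card {S. S \<subseteq> ?I \<and> card S = r}"
      unfolding count_isolated_def by (intro n_subsets[symmetric]) simp
    also have "{S. S \<subseteq> ?I \<and> card S = r} = {S \<in> subsets n r. \<forall>v\<in>S. isolated E v}"
      unfolding subsets_def by blast
    finally show ?thesis by (simp add: indicator_def sum.If_cases Int_def)
  qed
  then have "measure_pmf.expectation (G n m) (\<lambda>E. real (count_isolated n E choose r))
    = measure_pmf.expectation (G n m) (\<lambda>E. \<Sum>S\<in>subsets n r. indicator {E. \<forall>v\<in>S. isolated E v} E)"
    by simp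
  also have "\<dots> = (\<Sum>S\<in>subsets n r. measure_pmf.expectation (G n m) (indicator {E. \<forall>v\<in>S. isolated E v}))"
    by (intro Bochner_Integration.integral_sum integrable_bounded_pmf[where C = 1]) simp
  finally show ?thesis by (simp add: binomial_moment_def)
qed

lemma binomial_moment_le:
  assumes "n \<ge> 2"
  shows "binomial_moment n m r
    \<le> exp (real r * (ln n - \<kappa> * (m / n)) + (real r)\<^sup>2 * (m / n * e n)) / fact r"
proof -
  have "binomial_moment n m r \<le> (\<Sum>S\<in>subsets n r. exp (- (r * \<kappa> - (real r)\<^sup>2 * e n) * (m / n)))"
    unfolding binomial_moment_def
  proof (rule sum_mono)
    fix S assume S: "S \<in> subsets n r"
    let ?p = "measure_pmf.prob (D n) {E. \<forall>v\<in>S. isolated E v}"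
    have "finite S" using S by (auto simp: subsets_def intro: finite_subset)
    then have "?p \<le> 1 - (r * \<kappa> - (real r)\<^sup>2 * e n) / n"
      using prob_all_isolated_le[of S n] S assms by (auto simp: subsets_def)
    also have "\<dots> \<le> exp (- ((r * \<kappa> - (real r)\<^sup>2 * e n) / n))"
      using exp_ge_add_one_self[of "- ((r * \<kappa> - (real r)\<^sup>2 * e n) / n)"] by simp
    finally have "?p ^ m \<le> exp (- ((r * \<kappa> - (real r)\<^sup>2 * e n) / n)) ^ m"
      by (intro power_mono) auto
    also have "\<dots> = exp (real m * - ((r * \<kappa> - (real r)\<^sup>2 * e n) / n))"
      by (rule exp_of_nat_mult[symmetric])
    also have "real m * - ((r * \<kappa> - (real r)\<^sup>2 * e n) / n) = - (r * \<kappa> - (real r)\<^sup>2 * e n) * (m / n)"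
    proof -
      have "real m * - (z / n) = - z * (m / n)" for z by simp
      then show ?thesis .
    qed
    finally show "measure_pmf.prob (G n m) {E. \<forall>v\<in>S. isolated E v}
      \<le> exp (- (r * \<kappa> - (real r)\<^sup>2 * e n) * (m / n))" by (simp add: prob_G_all_isolated)
  qed
  also have "\<dots> = real (n choose r) * exp (- (r * \<kappa> - (real r)\<^sup>2 * e n) * (m / n))" by simp
  also have "real (n choose r) \<le> exp (real r * ln n) / fact r"
  proof -
    have "real (n choose r) * fact r \<le> real n ^ r"
      using binomial_fact_pow[of n r] by (metis of_nat_fact of_nat_le_iff of_nat_mult of_nat_power)
    then show ?thesis using assms by (simp add: exp_of_nat_mult field_simps)
  qed
  finally show ?thesis
    by (simp add: exp_add[symmetric] algebra_simps flip: exp_add)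
qed

lemma binomial_moment_ge:
  assumes "n \<ge> 2" "2 * real r * \<kappa> \<le> n"
  shows "real (n choose r) / real n ^ r * exp (real r * (ln n - \<kappa> * (m / n)) - 2 * (real r * \<kappa>)\<^sup>2 * (m / n / n))
    \<le> binomial_moment n m r"
proof -
  define y where "y = r * \<kappa> / n"
  have y: "0 \<le> y" "y \<le> 1 / 2" using assms kappa_pos by (auto simp: y_def field_simps)
  \<comment> \<open>The bound \<open>ln (1 - y) >= - y - 2 * y^2\<close> holds for
    \<open>y <= 1 / 2\<close>, which is what the second assumption says.\<close>
  have "exp (- y - 2 * y\<^sup>2) \<le> exp (ln (1 - y))"
    using ln_one_minus_pos_lower_bound[OF y] by simp
  also have "\<dots> = 1 - y" using y by simp
  finally have "exp (- y - 2 * y\<^sup>2) ^ m \<le> (1 - y) ^ m" by (intro power_mono) auto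
  then have le: "exp (- r * \<kappa> * (m / n) - 2 * (real r * \<kappa>)\<^sup>2 * (m / n / n)) \<le> (1 - y) ^ m"
    by (simp add: exp_of_nat_mult[symmetric] y_def field_simps power2_eq_square)
  have "real (n choose r) / real n ^ r * exp (real r * (ln n - \<kappa> * (m / n)) - 2 * (real r * \<kappa>)\<^sup>2 * (m / n / n))
    = real (n choose r) / real n ^ r * (exp (r * ln n) * exp (- r * \<kappa> * (m / n) - 2 * (real r * \<kappa>)\<^sup>2 * (m / n / n)))"
    by (simp add: exp_add[symmetric] algebra_simps flip: exp_add)
  also have "\<dots> = real (n choose r) * exp (- r * \<kappa> * (m / n) - 2 * (real r * \<kappa>)\<^sup>2 * (m / n / n))"
    using assms(1) by (simp add: exp_of_nat_mult)
  also have "\<dots> \<le> real (n choose r) * (1 - y) ^ m" using le by (intro mult_left_mono) auto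
  also have "\<dots> = (\<Sum>S\<in>subsets n r. (1 - y) ^ m)" by simp
  also have "\<dots> \<le> binomial_moment n m r"
    unfolding binomial_moment_def
  proof (rule sum_mono)
    fix S assume S: "S \<in> subsets n r"
    then have "1 - y \<le> measure_pmf.prob (D n) {E. \<forall>v\<in>S. isolated E v}"
      using prob_all_isolated_ge[of S n] by (auto simp: subsets_def y_def)
    then show "(1 - y) ^ m \<le> measure_pmf.prob (G n m) {E. \<forall>v\<in>S. isolated E v}"
      unfolding prob_G_all_isolated using y by (intro power_mono) auto
  qed
  finally show ?thesis .
qed

lemma no_isolated_eq:
  "no_isolated n m = measure_pmf.expectation (G n m) (\<lambda>E. of_bool (count_isolated n E = 0))"
proof -
  have "(\<lambda>E. of_bool (count_isolated n E = 0) :: real) = indicator {E. \<forall>v\<in>{1..n}. \<not> isolated E v}"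
    by (auto simp: count_isolated_eq_0_iff indicator_def fun_eq_iff)
  then show ?thesis by (simp add: no_isolated_def)
qed

lemma bonferroni:
  "\<bar>no_isolated n m - (\<Sum>r<R. (-1) ^ r * binomial_moment n m r)\<bar> \<le> binomial_moment n m R"
proof -
  let ?f = "\<lambda>E. of_bool (count_isolated n E = 0) - (\<Sum>r<R. (-1) ^ r * real (count_isolated n E choose r)) :: real"
  have int0: "integrable (G n m) (\<lambda>E. of_bool (count_isolated n E = 0) :: real)"
    by (rule integrable_bounded_pmf[where C = 1]) simp
  have int1: "integrable (G n m) (\<lambda>E. \<Sum>r<R. (-1) ^ r * real (count_isolated n E choose r))"
    by (intro Bochner_Integration.integrable_sum integrable_mult_right choose_count_integrable)
  have "no_isolated n m - (\<Sum>r<R. (-1) ^ r * binomial_moment n m r)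
     = measure_pmf.expectation (G n m) ?f"
    using int0 int1 choose_count_integrable
    by (simp add: no_isolated_eq binomial_moment_eq[symmetric])
  moreover have "\<bar>measure_pmf.expectation (G n m) ?f\<bar> \<le> measure_pmf.expectation (G n m) (\<lambda>E. \<bar>?f E\<bar>)"
    by (rule integral_abs_bound)
  moreover have "\<dots> \<le> measure_pmf.expectation (G n m) (\<lambda>E. real (count_isolated n E choose R))"
    using int0 int1 choose_count_integrable bonferroni_choose
    by (intro integral_mono integrable_abs Bochner_Integration.integrable_diff) auto
  ultimately show ?thesis unfolding binomial_moment_eq by linarith
qed

text \<open>Chebyshev's inequality: where the count is 0, its squared deviation from the mean equals
  the squared mean. The variance is expressed through
  \<open>N^2 = 2 * (N choose 2) + (N choose 1)\<close>.\<close>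

lemma second_moment_bound:
  "no_isolated n m * (binomial_moment n m 1)\<^sup>2
    \<le> 2 * binomial_moment n m 2 + binomial_moment n m 1 - (binomial_moment n m 1)\<^sup>2"
proof -
  let ?b = "binomial_moment n m 1"
  let ?N = "\<lambda>E. count_isolated n E"
  have sq: "(real N - ?b)\<^sup>2 = 2 * real (N choose 2) + real (N choose 1) - 2 * ?b * real (N choose 1) + ?b\<^sup>2" for N
  proof -
    have "real (N choose 2) = real N * (real N - 1) / 2"
      by (cases N) (auto simp: choose_two real_of_nat_div algebra_simps)
    then show ?thesis by (simp add: power2_eq_square algebra_simps)
  qed
  have "no_isolated n m * ?b\<^sup>2 = measure_pmf.expectation (G n m) (\<lambda>E. of_bool (?N E = 0) * ?b\<^sup>2)"
    by (simp add: no_isolated_eq)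
  also have "\<dots> \<le> measure_pmf.expectation (G n m)
      (\<lambda>E. 2 * real (?N E choose 2) + real (?N E choose 1) - 2 * ?b * real (?N E choose 1) + ?b\<^sup>2)"
  proof (rule integral_mono)
    show "integrable (G n m) (\<lambda>E. of_bool (?N E = 0) * ?b\<^sup>2)"
      by (rule integrable_bounded_pmf[where C = "?b\<^sup>2"]) simp
    show "of_bool (?N E = 0) * ?b\<^sup>2
      \<le> 2 * real (?N E choose 2) + real (?N E choose 1) - 2 * ?b * real (?N E choose 1) + ?b\<^sup>2" for E
      unfolding sq[symmetric] by simp
  qed (intro Bochner_Integration.integrable_add Bochner_Integration.integrable_diff
      integrable_mult_right choose_count_integrable, simp)
  also have "\<dots> = 2 * binomial_moment n m 2 + ?b - 2 * ?b * ?b + ?b\<^sup>2"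
    unfolding binomial_moment_eq[symmetric]
    using choose_count_integrable[of "G n m" n 1] choose_count_integrable[of "G n m" n 2] by simp
  finally show ?thesis by (simp add: power2_eq_square)
qed

subsection \<open>Isolated vertices\<close>

definition lam :: "(nat \<Rightarrow> nat) \<Rightarrow> nat \<Rightarrow> real" where
  "lam m n = ln (real n) - \<kappa> * (real (m n) / real n)"

text \<open>A lower bound on \<open>lam\<close> is an upper bound on \<open>m / n\<close>. It holds
  in the critical regime and when \<open>lam\<close> tends to infinity, where it keeps the error
  exponents small; the 2 absorbs the constant \<open>b\<close>.\<close>

lemma ratio_eventually_le_ln:
  assumes "\<forall>\<^sub>F n in sequentially. b \<le> lam m n"
  shows "\<forall>\<^sub>F n in sequentially. real (m n) / real n \<le> 2 / \<kappa> * ln (real n)"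
proof -
  have "\<forall>\<^sub>F n in sequentially. - b \<le> ln (real n)"
    using ln_nat_at_top by (auto simp: filterlim_at_top)
  with assms show ?thesis
  proof eventually_elim
    case (elim n)
    then have "\<kappa> * (real (m n) / real n) \<le> 2 * ln (real n)" by (simp add: lam_def)
    then have "real (m n) / real n \<le> 2 * ln (real n) / \<kappa>"
      using kappa_pos by (simp add: pos_le_divide_eq mult.commute)
    then show ?case by simp
  qed
qed

text \<open>With \<open>m / n\<close> of order at most \<open>ln n\<close>, this is
  \<open>e s * ln s --> 0\<close> along \<open>s = n\<close>.\<close>

lemma ratio_mult_e_tendsto_0:
  assumes "\<forall>\<^sub>F n in sequentially. b \<le> lam m n"
  shows "(\<lambda>n. real (m n) / real n * e (real n)) \<longlonglongrightarrow> 0"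
proof -
  have "(\<lambda>n. 2 / \<kappa> * (e (real n) * ln (real n))) \<longlonglongrightarrow> 2 / \<kappa> * 0"
    by (intro tendsto_mult_left filterlim_compose[OF e_ln_tendsto filterlim_real_sequentially])
  then have lim: "(\<lambda>n. 2 / \<kappa> * (e (real n) * ln (real n))) \<longlonglongrightarrow> 0" by simp
  show ?thesis
  proof (rule real_tendsto_sandwich[OF _ _ tendsto_const lim])
    show "\<forall>\<^sub>F n in sequentially. 0 \<le> real (m n) / real n * e (real n)"
      using eventually_gt_at_top[of 0] by eventually_elim (simp add: e_nonneg)
    show "\<forall>\<^sub>F n in sequentially. real (m n) / real n * e (real n) \<le> 2 / \<kappa> * (e (real n) * ln (real n))"
      using ratio_eventually_le_ln[OF assms] eventually_gt_at_top[of 0]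
    proof eventually_elim
      case (elim n)
      then have "real (m n) / real n * e (real n) \<le> 2 / \<kappa> * ln (real n) * e (real n)"
        by (intro mult_right_mono e_nonneg) auto
      then show ?case by (simp add: mult_ac)
    qed
  qed
qed

lemma ratio_div_tendsto_0:
  assumes "\<forall>\<^sub>F n in sequentially. b \<le> lam m n"
  shows "(\<lambda>n. real (m n) / real n / real n) \<longlonglongrightarrow> 0"
proof -
  have "(\<lambda>n. 2 / \<kappa> * (ln (real n) / real n)) \<longlonglongrightarrow> 2 / \<kappa> * 0"
    by (intro tendsto_mult_left filterlim_compose[OF ln_x_over_x_tendsto_0 filterlim_real_sequentially])
  then have lim: "(\<lambda>n. 2 / \<kappa> * (ln (real n) / real n)) \<longlonglongrightarrow> 0" by simp
  show ?thesis
  proof (rule real_tendsto_sandwich[OF _ _ tendsto_const lim])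
    show "\<forall>\<^sub>F n in sequentially. real (m n) / real n / real n \<le> 2 / \<kappa> * (ln (real n) / real n)"
      using ratio_eventually_le_ln[OF assms]
    proof eventually_elim
      case (elim n)
      then have "real (m n) / real n / real n \<le> 2 / \<kappa> * ln (real n) / real n"
        by (intro divide_right_mono) auto
      then show ?case by simp
    qed
  qed simp
qed

lemma binomial_moment_tendsto:
  assumes "lam m \<longlonglongrightarrow> c"
  shows "(\<lambda>n. binomial_moment n (m n) r) \<longlonglongrightarrow> exp (real r * c) / fact r"
proof -
  have ev: "\<forall>\<^sub>F n in sequentially. c - 1 \<le> lam m n"
    using order_tendstoD(1)[OF assms, of "c - 1"] by (auto elim: eventually_mono)
  have up: "(\<lambda>n. exp (real r * lam m n + (real r)\<^sup>2 * (m n / n * e n)) / fact r)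
      \<longlonglongrightarrow> exp (real r * c + (real r)\<^sup>2 * 0) / fact r"
    by (intro tendsto_intros ratio_mult_e_tendsto_0[OF ev] assms) simp
  have lo: "(\<lambda>n. real (n choose r) / real n ^ r * exp (real r * lam m n - 2 * (real r * \<kappa>)\<^sup>2 * (m n / n / n)))
      \<longlonglongrightarrow> 1 / fact r * exp (real r * c - 2 * (real r * \<kappa>)\<^sup>2 * 0)"
    by (rule tendsto_mult[OF choose_div_power_tendsto])
       (intro tendsto_intros ratio_div_tendsto_0[OF ev] assms)
  show ?thesis
  proof (rule real_tendsto_sandwich)
    show "\<forall>\<^sub>F n in sequentially. binomial_moment n (m n) r
      \<le> exp (real r * lam m n + (real r)\<^sup>2 * (m n / n * e n)) / fact r"
      using eventually_ge_at_top[of 2] by eventually_elim (simp only: lam_def binomial_moment_le)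
    have "\<forall>\<^sub>F n in sequentially. 2 * real r * \<kappa> \<le> real n"
      using filterlim_real_sequentially by (auto simp: filterlim_at_top)
    then show "\<forall>\<^sub>F n in sequentially. real (n choose r) / real n ^ r
      * exp (real r * lam m n - 2 * (real r * \<kappa>)\<^sup>2 * (m n / n / n)) \<le> binomial_moment n (m n) r"
      using eventually_ge_at_top[of 2] by eventually_elim (simp only: lam_def binomial_moment_ge)
  qed (use up lo in simp_all)
qed

text \<open>\<open>R\<close> is fixed first, so that both the tail of the series of
  \<open>exp (- exp c)\<close> and the limit of the \<open>R\<close>-th binomial moment are small;
  only then does \<open>n\<close> grow. No uniformity in \<open>r\<close> is required.\<close>

lemma no_isolated_tendsto:
  assumes "lam m \<longlonglongrightarrow> c"
  shows "(\<lambda>n. no_isolated n (m n)) \<longlonglongrightarrow> exp (- exp c)"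
proof (rule LIMSEQ_I)
  fix \<epsilon> :: real assume "\<epsilon> > 0"
  let ?T = "\<lambda>R. \<Sum>r<R. (-1) ^ r * (exp (real r * c) / fact r)"
  have "(\<lambda>r. (- exp c) ^ r /\<^sub>R fact r) = (\<lambda>r. (-1) ^ r * (exp (real r * c) / fact r))"
    unfolding exp_of_nat_mult power_minus[of "exp c"] by (simp add: fun_eq_iff divide_inverse)
  then have "?T \<longlonglongrightarrow> exp (- exp c)"
    using exp_converges[of "- exp c"] by (simp add: sums_def)
  then have ev1: "\<forall>\<^sub>F R in sequentially. dist (?T R) (exp (- exp c)) < \<epsilon> / 4"
    using \<open>\<epsilon> > 0\<close> by (intro tendstoD) auto
  have "(\<lambda>r. exp c ^ r /\<^sub>R fact r) = (\<lambda>r. exp (real r * c) / fact r)"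
    unfolding exp_of_nat_mult by (simp add: fun_eq_iff divide_inverse)
  then have "(\<lambda>r. exp (real r * c) / fact r) \<longlonglongrightarrow> 0"
    using summable_LIMSEQ_zero[OF sums_summable[OF exp_converges[of "exp c"]]] by simp
  then have ev2: "\<forall>\<^sub>F R in sequentially. exp (real R * c) / fact R < \<epsilon> / 4"
    using \<open>\<epsilon> > 0\<close> by (intro order_tendstoD(2)) auto
  obtain R where R: "dist (?T R) (exp (- exp c)) < \<epsilon> / 4" "exp (real R * c) / fact R < \<epsilon> / 4"
    using eventually_conj[OF ev1 ev2] by (auto simp: eventually_sequentially)
  have "(\<lambda>n. \<Sum>r<R. (-1) ^ r * binomial_moment n (m n) r) \<longlonglongrightarrow> ?T R"
    by (intro tendsto_sum tendsto_mult_left binomial_moment_tendsto assms)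
  then have "\<forall>\<^sub>F n in sequentially. dist (\<Sum>r<R. (-1) ^ r * binomial_moment n (m n) r) (?T R) < \<epsilon> / 4"
    using \<open>\<epsilon> > 0\<close> by (intro tendstoD) auto
  moreover have "\<forall>\<^sub>F n in sequentially. binomial_moment n (m n) R < \<epsilon> / 4"
    using binomial_moment_tendsto[OF assms, of R] R(2) by (rule order_tendstoD(2))
  ultimately have "\<forall>\<^sub>F n in sequentially. norm (no_isolated n (m n) - exp (- exp c)) < \<epsilon>"
  proof eventually_elim
    case (elim n)
    then show ?case
      using R(1) bonferroni[of n "m n" R] \<open>\<epsilon> > 0\<close> unfolding dist_real_def real_norm_def by linarith
  qed
  then show "\<exists>N. \<forall>n\<ge>N. norm (no_isolated n (m n) - exp (- exp c)) < \<epsilon>"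
    by (simp add: eventually_sequentially)
qed

text \<open>After division by the squared mean the second moment bound reads
  \<open>2 * b2 / b1^2 + 1 / b1 - 1\<close>. Here \<open>b1\<close> tends to infinity, and the first
  term is asymptotically at most 1.\<close>

lemma no_isolated_tendsto_0:
  assumes "filterlim (lam m) at_top sequentially"
  shows "(\<lambda>n. no_isolated n (m n)) \<longlonglongrightarrow> 0"
proof -
  have ev: "\<forall>\<^sub>F n in sequentially. 0 \<le> lam m n"
    using assms by (auto simp: filterlim_at_top)
  \<comment> \<open>The error exponents of the moment bounds: \<open>?e\<close> enters the upper
    bound for \<open>r = 2\<close> with weight \<open>r^2 = 4\<close>, and \<open>?d\<close> is the
    one in the lower bound for \<open>r = 1\<close>, doubled when that bound is squared.\<close>
  let ?e = "\<lambda>n. m n / n * e n" and ?d = "\<lambda>n. 2 * \<kappa>\<^sup>2 * (m n / n / n)"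
  have d: "?d \<longlonglongrightarrow> 2 * \<kappa>\<^sup>2 * 0"
    by (intro tendsto_mult_left ratio_div_tendsto_0[OF ev])
  have "filterlim (\<lambda>n. ?d n + - lam m n) at_bot sequentially"
    unfolding filterlim_uminus_at_bot
    using filterlim_tendsto_add_at_top[OF tendsto_minus[OF d] assms] by simp
  then have "(\<lambda>n. exp (?d n + - lam m n)) \<longlonglongrightarrow> 0"
    by (rule filterlim_compose[OF exp_at_bot])
  moreover have "(\<lambda>n. exp (4 * ?e n + 2 * ?d n)) \<longlonglongrightarrow> exp (4 * 0 + 2 * (2 * \<kappa>\<^sup>2 * 0))"
    by (intro tendsto_exp tendsto_add tendsto_mult_left ratio_mult_e_tendsto_0[OF ev]
        ratio_div_tendsto_0[OF ev])
  ultimately have "(\<lambda>n. exp (4 * ?e n + 2 * ?d n) + exp (?d n + - lam m n) - 1) \<longlonglongrightarrow> exp (4 * 0 + 2 * (2 * \<kappa>\<^sup>2 * 0)) + 0 - 1"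
    by (intro tendsto_add tendsto_diff tendsto_const)
  then have lim: "(\<lambda>n. exp (4 * ?e n + 2 * ?d n) + exp (?d n + - lam m n) - 1) \<longlonglongrightarrow> 0" by simp
  show ?thesis
  proof (rule real_tendsto_sandwich[OF _ _ tendsto_const lim])
    have "\<forall>\<^sub>F n in sequentially. 2 * \<kappa> \<le> real n"
      using filterlim_real_sequentially by (auto simp: filterlim_at_top)
    then show "\<forall>\<^sub>F n in sequentially. no_isolated n (m n) \<le> exp (4 * ?e n + 2 * ?d n) + exp (?d n + - lam m n) - 1"
      using eventually_ge_at_top[of 2]
    proof eventually_elim
      case (elim n)
      let ?b1 = "binomial_moment n (m n) 1" and ?b2 = "binomial_moment n (m n) 2"
      have b1: "exp (lam m n - ?d n) \<le> ?b1"
        using binomial_moment_ge[of n 1 "m n"] elim by (simp add: lam_def)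
      have pos: "0 < ?b1" using b1 exp_gt_zero[of "lam m n - ?d n"] by linarith
      have b2: "2 * ?b2 \<le> exp (2 * lam m n + 4 * ?e n)"
        using binomial_moment_le[of n "m n" 2] elim by (simp add: lam_def)
      have "no_isolated n (m n) * ?b1\<^sup>2 \<le> 2 * ?b2 + ?b1 - ?b1\<^sup>2" by (rule second_moment_bound)
      then have "no_isolated n (m n) \<le> (2 * ?b2 + ?b1 - ?b1\<^sup>2) / ?b1\<^sup>2"
        using pos by (simp add: pos_le_divide_eq)
      also have "\<dots> = 2 * ?b2 / ?b1\<^sup>2 + 1 / ?b1 - 1"
        using pos by (simp add: diff_divide_distrib add_divide_distrib power2_eq_square)
      also have "2 * ?b2 / ?b1\<^sup>2 \<le> exp (2 * lam m n + 4 * ?e n) / (exp (lam m n - ?d n))\<^sup>2"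
        using b2 b1 by (intro frac_le power_mono) auto
      also have "\<dots> = exp (4 * ?e n + 2 * ?d n)"
        by (simp add: exp_double[symmetric] exp_diff[symmetric] algebra_simps)
      also have "1 / ?b1 \<le> 1 / exp (lam m n - ?d n)"
        using b1 by (intro divide_left_mono mult_pos_pos pos exp_gt_zero) simp_all
      also have "\<dots> = exp (?d n + - lam m n)"
        by (simp add: exp_diff field_simps exp_minus)
      finally show ?case by simp
    qed
  qed (simp add: no_isolated_def)
qed

lemma conn_le_no_isolated: "n \<ge> 2 \<Longrightarrow> conn n m \<le> no_isolated n m"
  unfolding conn_def no_isolated_def
  using connected_graph_not_isolated by (intro measure_pmf.finite_measure_mono) (blast, simp)

subsection \<open>Larger separated sets\<close>

definition cut_sum :: "nat \<Rightarrow> nat \<Rightarrow> nat \<Rightarrow> real" where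
  "cut_sum n m k = (\<Sum>S\<in>subsets n k. measure_pmf.prob (G n m) {E. separated E S})"

definition edge_cut_sum :: "nat \<Rightarrow> nat \<Rightarrow> nat \<Rightarrow> real" where
  "edge_cut_sum n m k =
    (\<Sum>S\<in>subsets n k. measure_pmf.prob (G n m) {E. separated E S \<and> (\<exists>x\<in>E. x \<subseteq> S)})"

text \<open>A lower bound for the probability that one draw crosses the boundary of a given
  k-set.\<close>

definition cut_rate :: "nat \<Rightarrow> nat \<Rightarrow> real" where
  "cut_rate n k = real k / real n * (\<kappa> - e (real n / real k))"

lemma subsetsD:
  assumes "S \<in> subsets n k" "k \<ge> 1"
  shows "S \<subseteq> {1..n}" "S \<noteq> {}" "card S = k" "finite S"
  using assms by (auto simp: subsets_def intro: finite_subset)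

lemma cut_sum_le_local:
  assumes "1 \<le> k" "2 * k \<le> n"
  shows "cut_sum n m k \<le> real (n choose k) * exp (- (real m * cut_rate n k))"
proof -
  have "cut_sum n m k \<le> (\<Sum>S\<in>subsets n k. exp (- (real m * cut_rate n k)))"
    unfolding cut_sum_def prob_G_separated
  proof (intro sum_mono power_le_exp_minus)
    fix S assume S: "S \<in> subsets n k"
    show "measure_pmf.prob (D n) {E. separated E S} \<le> 1 - cut_rate n k"
      using separated_local[of S n] subsetsD[OF S assms(1)] assms(2) by (simp add: cut_rate_def)
  qed simp
  then show ?thesis by simp
qed

lemma cut_sum_le_global:
  assumes "1 \<le> k" "2 * k \<le> n"
  shows "cut_sum n m k \<le> real (n choose k) * exp (- (real m * (real k / real n * \<mu>)))"
proof -
  have "cut_sum n m k \<le> (\<Sum>S\<in>subsets n k. exp (- (real m * (real k / real n * \<mu>))))"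
    unfolding cut_sum_def prob_G_separated
  proof (intro sum_mono power_le_exp_minus)
    fix S assume S: "S \<in> subsets n k"
    show "measure_pmf.prob (D n) {E. separated E S} \<le> 1 - real k / real n * \<mu>"
      using separated_global[of S n] subsetsD[OF S assms(1)] assms(2) by simp
  qed simp
  then show ?thesis by simp
qed

lemma edge_cut_sum_le_cut_sum: "edge_cut_sum n m k \<le> cut_sum n m k"
  unfolding edge_cut_sum_def cut_sum_def
  by (intro sum_mono measure_pmf.finite_measure_mono) auto

text \<open>An edge inside \<open>S\<close> makes two distinct vertices of \<open>S\<close>
  non-isolated within a single draw, so the pair estimate applies to each ordered pair.\<close>

lemma prob_edge_inside:
  assumes "S \<subseteq> {1..n}" "finite S" "n \<ge> 1"
  shows "measure_pmf.prob (D n) {E. \<exists>x\<in>E. x \<subseteq> S} \<le> (real (card S))\<^sup>2 * (e n / n)"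
proof -
  let ?I = "{z \<in> S \<times> S. fst z \<noteq> snd z}"
  have fin: "finite ?I" using assms by auto
  have "measure_pmf.prob (D n) {E. \<exists>x\<in>E. x \<subseteq> S}
    \<le> (\<Sum>z\<in>?I. measure_pmf.prob (D n) {E. \<not> isolated E (fst z) \<and> \<not> isolated E (snd z)})"
  proof (rule prob_pmf_le_sum[OF fin])
    fix E assume E: "E \<in> set_pmf (D n)" and "E \<in> {E. \<exists>x\<in>E. x \<subseteq> S}"
    then obtain x where x: "x \<in> E" "x \<subseteq> S" by blast
    then have "card x = 2" using E edges[of n] by (auto simp: pairs_def)
    then obtain u v where uv: "x = {u, v}" "u \<noteq> v" by (auto simp: card_2_iff)
    then have "\<not> isolated E u" "\<not> isolated E v" using x by (auto simp: isolated_def)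
    then show "\<exists>z\<in>?I. E \<in> {E. \<not> isolated E (fst z) \<and> \<not> isolated E (snd z)}"
      using uv x by (intro bexI[of _ "(u, v)"]) auto
  qed
  also have "\<dots> \<le> (\<Sum>z\<in>?I. e n / n)"
    using assms by (intro sum_mono not_isolated_pair) auto
  also have "\<dots> = real (card ?I) * (e n / n)" by simp
  also have "\<dots> \<le> (real (card S))\<^sup>2 * (e n / n)"
  proof (rule mult_right_mono)
    have "card ?I \<le> card (S \<times> S)" using assms by (intro card_mono) auto
    then show "real (card ?I) \<le> (real (card S))\<^sup>2"
      by (simp add: card_cartesian_product power2_eq_square flip: of_nat_mult)
  qed (use assms e_nonneg[of n] in simp)
  finally show ?thesis .
qed

lemma edge_cut_sum_le:
  assumes "1 \<le> k" "2 * k \<le> n"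
  shows "edge_cut_sum n m k
    \<le> exp 1 * (real k)\<^sup>2 * (real m / real n * e n) * (real (n choose k) * exp (- (real m * cut_rate n k)))"
proof -
  have n: "n \<ge> 1" using assms by simp
  have "edge_cut_sum n m k
    \<le> (\<Sum>S\<in>subsets n k. real m * ((real k)\<^sup>2 * (e n / n)) * (exp 1 * exp (- (real m * cut_rate n k))))"
    unfolding edge_cut_sum_def
  proof (rule sum_mono)
    fix S assume S: "S \<in> subsets n k"
    note S' = subsetsD[OF S assms(1)]
    let ?p = "measure_pmf.prob (D n) {E. separated E S}"
    have p: "?p \<le> 1 - cut_rate n k"
      using separated_local[of S n] S' assms(2) by (simp add: cut_rate_def)
    then have r: "cut_rate n k \<le> 1" using measure_nonneg[of "D n" "{E. separated E S}"] by linarith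
    have "?p ^ (m - 1) \<le> exp (- (real (m - 1) * cut_rate n k))"
      using p by (intro power_le_exp_minus) auto
    \<comment> \<open>The draw that supplies the edge is missing from the power. As
      \<open>cut_rate\<close> is at most 1, putting it back costs the factor
      \<open>exp 1\<close>.\<close>
    also have "\<dots> \<le> exp (1 + - (real m * cut_rate n k))"
    proof (cases m)
      case (Suc m')
      then show ?thesis using r by (simp add: algebra_simps)
    qed simp
    finally have pw: "?p ^ (m - 1) \<le> exp 1 * exp (- (real m * cut_rate n k))" by (simp only: exp_add)
    have "measure_pmf.prob (G n m) {E. separated E S \<and> (\<exists>x\<in>E. x \<subseteq> S)}
      \<le> real m * measure_pmf.prob (D n) {E. \<exists>x\<in>E. x \<subseteq> S} * ?p ^ (m - 1)"
      using prob_union_pmf_all_ex[of "D n" m "\<lambda>x. x \<subseteq> S \<or> x \<inter> S = {}" "\<lambda>x. x \<subseteq> S"]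
      by (simp add: G_def separated_def)
    also have "\<dots> \<le> real m * ((real k)\<^sup>2 * (e n / n)) * (exp 1 * exp (- (real m * cut_rate n k)))"
      using prob_edge_inside[OF S'(1,4) n] S'(3) pw e_nonneg[of n] n
      by (intro mult_mono mult_left_mono) auto
    finally show "measure_pmf.prob (G n m) {E. separated E S \<and> (\<exists>x\<in>E. x \<subseteq> S)}
      \<le> real m * ((real k)\<^sup>2 * (e n / n)) * (exp 1 * exp (- (real m * cut_rate n k)))" .
  qed
  then show ?thesis by (simp add: mult_ac)
qed

lemma disconnected_le_cut_sums:
  assumes "n \<ge> 2"
  shows "1 - conn n m \<le> (\<Sum>k\<in>{1..n div 2}. cut_sum n m k)"
proof -
  let ?I = "SIGMA k:{1..n div 2}. subsets n k"
  have "1 - conn n m = measure_pmf.prob (G n m) {E. \<not> connected_graph ({1..n}, E)}"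
    unfolding conn_def prob_pmf_not ..
  also have "\<dots> \<le> (\<Sum>z\<in>?I. measure_pmf.prob (G n m) {E. separated E (snd z)})"
  proof (rule prob_pmf_le_sum)
    fix E assume E: "E \<in> set_pmf (G n m)" "E \<in> {E. \<not> connected_graph ({1..n}, E)}"
    then have "E \<subseteq> pairs {1..n}" "\<not> connected_graph ({1..n}, E)" using set_G by blast+
    then obtain S where S: "S \<subseteq> {1..n}" "S \<noteq> {}" "2 * card S \<le> n" "separated E S"
      using disconnected_obtains_separated[of E n] assms by (metis One_nat_def Suc_1 Suc_leD)
    then have "finite S" by (auto intro: finite_subset)
    then have "card S \<ge> 1" using S by (simp add: Suc_le_eq card_gt_0_iff)
    then have "(card S, S) \<in> ?I" using S by (auto simp: subsets_def)
    then show "\<exists>z\<in>?I. E \<in> {E. separated E (snd z)}" using S by (intro bexI[of _ "(card S, S)"]) auto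
  qed simp
  also have "\<dots> = (\<Sum>k\<in>{1..n div 2}. cut_sum n m k)"
    unfolding cut_sum_def by (subst sum.Sigma) (auto simp: case_prod_unfold)
  finally show ?thesis .
qed

text \<open>Without isolated vertices every vertex of a separated set has an edge, and separation
  confines that edge to the set. Hence the set has at least two vertices, and an edge inside it is
  guaranteed.\<close>

lemma no_isolated_minus_conn_le:
  assumes "n \<ge> 2"
  shows "no_isolated n m - conn n m \<le> (\<Sum>k\<in>{2..n div 2}. edge_cut_sum n m k)"
proof -
  let ?I = "SIGMA k:{2..n div 2}. subsets n k"
  let ?P = "measure_pmf.prob (G n m)"
  have "no_isolated n m
    \<le> ?P ({E. connected_graph ({1..n}, E)} \<union> {E. (\<forall>v\<in>{1..n}. \<not> isolated E v) \<and> \<not> connected_graph ({1..n}, E)})"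
    unfolding no_isolated_def by (intro measure_pmf.finite_measure_mono) auto
  also have "\<dots> \<le> conn n m + ?P {E. (\<forall>v\<in>{1..n}. \<not> isolated E v) \<and> \<not> connected_graph ({1..n}, E)}"
    unfolding conn_def by (intro measure_Un_le) auto
  also have "?P {E. (\<forall>v\<in>{1..n}. \<not> isolated E v) \<and> \<not> connected_graph ({1..n}, E)}
    \<le> (\<Sum>z\<in>?I. ?P {E. separated E (snd z) \<and> (\<exists>x\<in>E. x \<subseteq> snd z)})"
  proof (rule prob_pmf_le_sum)
    fix E assume E: "E \<in> set_pmf (G n m)"
      "E \<in> {E. (\<forall>v\<in>{1..n}. \<not> isolated E v) \<and> \<not> connected_graph ({1..n}, E)}"
    then have sub: "E \<subseteq> pairs {1..n}" and disc: "\<not> connected_graph ({1..n}, E)"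
      and iso: "\<And>v. v \<in> {1..n} \<Longrightarrow> \<not> isolated E v" using set_G by blast+
    obtain S where S: "S \<subseteq> {1..n}" "S \<noteq> {}" "2 * card S \<le> n" "separated E S"
      using disconnected_obtains_separated[OF sub _ disc] assms by (metis One_nat_def Suc_1 Suc_leD)
    then have "finite S" by (auto intro: finite_subset)
    then have "card S \<ge> 1" using S by (simp add: Suc_le_eq card_gt_0_iff)
    moreover have "card S \<noteq> 1"
    proof
      assume "card S = 1"
      then obtain v where "S = {v}" by (auto simp: card_1_singleton_iff)
      then show False using S separated_singleton_iff_isolated[OF sub, of v] iso[of v] by auto
    qed
    ultimately have mem: "(card S, S) \<in> ?I" using S by (auto simp: subsets_def)
    obtain v where v: "v \<in> S" using S by blast
    then have "v \<in> {1..n}" using S(1) by blast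
    then obtain x where x: "x \<in> E" "v \<in> x" using iso[of v] unfolding isolated_def by blast
    then have "x \<subseteq> S" using S(4) v by (auto simp: separated_def)
    then show "\<exists>z\<in>?I. E \<in> {E. separated E (snd z) \<and> (\<exists>x\<in>E. x \<subseteq> snd z)}"
      using S x mem by (intro bexI[of _ "(card S, S)"]) auto
  qed simp
  also have "\<dots> = (\<Sum>k\<in>{2..n div 2}. edge_cut_sum n m k)"
    unfolding edge_cut_sum_def by (subst sum.Sigma) (auto simp: case_prod_unfold)
  finally show ?thesis by simp
qed

text \<open>From \<open>exp 1\<close> on the logarithm is at least 1, so the bound on
  \<open>e s * ln s\<close> passes to \<open>e s\<close>. The quarter makes the relative loss
  \<open>e s / \<kappa>\<close> at most 1/4.\<close>

lemma e_ln_eventually_small: "\<exists>s0\<ge>exp 1. \<forall>s\<ge>s0. e s * ln s \<le> \<kappa> / 4 \<and> e s \<le> \<kappa> / 4"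
proof -
  have "\<forall>\<^sub>F s in at_top. e s * ln s < \<kappa> / 4"
    using e_ln_tendsto kappa_pos by (intro order_tendstoD(2)) auto
  then obtain s1 where s1: "\<And>s. s \<ge> s1 \<Longrightarrow> e s * ln s < \<kappa> / 4"
    by (auto simp: eventually_at_top_linorder)
  define s0 where "s0 = max s1 (exp 1)"
  have "e s * ln s \<le> \<kappa> / 4 \<and> e s \<le> \<kappa> / 4" if s: "s \<ge> s0" for s
  proof -
    have s_ge: "s \<ge> exp 1" "s \<ge> s1" using s by (auto simp: s0_def)
    then have "s > 0" using exp_gt_zero[of "1 :: real"] by linarith
    then have "ln s \<ge> 1" using s_ge by (simp add: ln_ge_iff)
    then have "e s * 1 \<le> e s * ln s" using e_nonneg[OF \<open>s > 0\<close>] by (intro mult_left_mono)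
    then show ?thesis using s1[OF s_ge(2)] by simp
  qed
  then show ?thesis by (intro exI[of _ s0]) (simp add: s0_def)
qed

text \<open>\<open>A\<close> is a lower bound for \<open>- lam\<close>. It may be negative in the
  critical regime, hence the absolute value.\<close>

definition cut_base :: "real \<Rightarrow> real" where
  "cut_base A = exp (2 - A + \<bar>A\<bar> / 4)"

text \<open>
  With \<open>\<delta> = e (n / k) / \<kappa>\<close>, the logarithm of the left-hand side is at most
  \<open>k (1 - ln k + \<delta> ln n - A (1 - \<delta>))\<close>, and the moment condition enters through
  \<open>\<delta> ln n = \<delta> ln (n / k) + \<delta> ln k \<le> (1 + ln k) / 4\<close>.
\<close>

lemma choose_mult_exp_cut_rate_le:
  assumes s0: "s0 \<ge> exp 1" "\<And>s. s \<ge> s0 \<Longrightarrow> e s * ln s \<le> \<kappa> / 4 \<and> e s \<le> \<kappa> / 4"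
    and k: "1 \<le> k" "real k * s0 \<le> real n"
    and m: "\<kappa> * (real m / real n) \<ge> ln n + A" "ln n + A \<ge> 0"
  shows "real (n choose k) * exp (- (real m * cut_rate n k)) \<le> (cut_base A / sqrt k) ^ k"
proof -
  define s where "s = real n / real k"
  define \<delta> where "\<delta> = e s / \<kappa>"
  have s_ge: "s \<ge> s0" using k by (simp add: s_def pos_le_divide_eq mult.commute)
  have s_pos: "s > 0" using s_ge s0(1) exp_gt_zero[of "1 :: real"] by linarith
  have n: "n \<ge> 1" using s_pos k by (cases n) (auto simp: s_def)
  have lnk: "0 \<le> ln (real k)" using k by simp
  have d: "0 \<le> \<delta>" "\<delta> \<le> 1 / 4" "\<delta> * ln s \<le> 1 / 4"
    using s0(2)[OF s_ge] e_nonneg[OF s_pos] kappa_pos by (auto simp: \<delta>_def field_simps)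
  have "ln (real n) = ln s + ln (real k)" using n k by (simp add: s_def ln_div)
  then have "\<delta> * ln (real n) = \<delta> * ln s + \<delta> * ln (real k)" by (simp only: distrib_left)
  also have "\<dots> \<le> 1 / 4 + 1 / 4 * ln (real k)" using d lnk by (intro add_mono mult_right_mono) auto
  finally have dn: "\<delta> * ln (real n) \<le> 1 / 4 + 1 / 4 * ln (real k)" .
  have "\<delta> * A \<le> \<delta> * \<bar>A\<bar>" using d by (intro mult_left_mono) auto
  also have "\<dots> \<le> 1 / 4 * \<bar>A\<bar>" using d by (intro mult_right_mono) auto
  finally have dA: "\<delta> * A \<le> \<bar>A\<bar> / 4" by simp
  have eq: "real m * cut_rate n k = real k * ((\<kappa> * (real m / real n)) * (1 - \<delta>))"
  proof -
    have "\<kappa> - e s = \<kappa> * (1 - \<delta>)" using kappa_pos by (simp add: \<delta>_def field_simps)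
    then show ?thesis unfolding cut_rate_def s_def by simp
  qed
  have le: "(ln n + A) * (1 - \<delta>) \<le> (\<kappa> * (real m / real n)) * (1 - \<delta>)"
    using m d by (intro mult_right_mono) auto
  have rate: "real k * ((ln n + A) * (1 - \<delta>)) \<le> real m * cut_rate n k"
    unfolding eq by (rule mult_left_mono[OF le]) simp
  have "real (n choose k) * exp (- (real m * cut_rate n k))
    \<le> exp (real k * (ln n + 1 - ln k)) * exp (- (real k * ((ln n + A) * (1 - \<delta>))))"
    using rate choose_le_exp[OF n k(1)] by (intro mult_mono) auto
  also have "\<dots> = exp (real k * (1 - ln k + \<delta> * ln n - A + \<delta> * A))"
    by (simp add: exp_add[symmetric] algebra_simps flip: exp_add)
  also have "\<dots> \<le> exp (real k * (2 - A + \<bar>A\<bar> / 4 - ln k / 2))"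
    unfolding exp_le_cancel_iff
  \<comment> \<open>The estimates give the constant 5/4 and the slope -3/4 in \<open>ln k\<close>,
    weakened to 2 and -1/2. A negative slope is what matters: it yields the \<open>sqrt k\<close> in
    the denominator.\<close>
  proof (rule mult_left_mono)
    show "1 - ln k + \<delta> * ln n - A + \<delta> * A \<le> 2 - A + \<bar>A\<bar> / 4 - ln k / 2"
      using dn dA lnk by linarith
  qed simp
  also have "\<dots> = (exp (2 - A + \<bar>A\<bar> / 4 - ln k / 2)) ^ k" by (rule exp_of_nat_mult)
  also have "exp (2 - A + \<bar>A\<bar> / 4 - ln k / 2) = cut_base A / sqrt k"
    using k by (simp add: exp_diff cut_base_def ln_sqrt[symmetric])
  finally show ?thesis .
qed

text \<open>The sum splits at \<open>k = n / s0\<close>. Up to there the sharp rate is used, beyond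
  it the crude one, whose total contribution is at most \<open>exp (- n)\<close>. Quantifying over
  \<open>m\<close> and \<open>K\<close> inside makes the threshold for \<open>n\<close> independent
  of both.\<close>

lemma cut_sums_eventually_le:
  "\<forall>\<^sub>F n in sequentially. \<forall>m K. ln n + A \<le> \<kappa> * (real m / real n) \<longrightarrow> 1 \<le> K \<longrightarrow>
    (\<Sum>k\<in>{K..n div 2}. cut_sum n m k) \<le> (\<Sum>k\<in>{K..n div 2}. (cut_base A / sqrt k) ^ k) + exp (- real n)"
proof -
  obtain s0 where s0: "s0 \<ge> exp 1" "\<And>s. s \<ge> s0 \<Longrightarrow> e s * ln s \<le> \<kappa> / 4 \<and> e s \<le> \<kappa> / 4"
    using e_ln_eventually_small by blast
  have s0_pos: "s0 > 0" using s0(1) exp_gt_zero[of "1 :: real"] by linarith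
  \<comment> \<open>The second entry gives
    \<open>\<kappa> * m / n >= 2 * s0 * \<kappa> / \<mu>\<close>, that is,
    \<open>m * \<mu> / s0 >= 2 * n\<close>.\<close>
  have "\<forall>\<^sub>F n in sequentially. max (- A) (2 * s0 * \<kappa> / \<mu> - A) \<le> ln (real n)"
    using filterlim_compose[OF ln_at_top filterlim_real_sequentially] unfolding filterlim_at_top by blast
  then show ?thesis using eventually_ge_at_top[of 1]
  proof eventually_elim
    case (elim n)
    show ?case
    proof (intro allI impI)
      fix m K :: nat assume m: "ln n + A \<le> \<kappa> * (real m / real n)" and K: "1 \<le> K"
      have nonneg: "ln n + A \<ge> 0" using elim by auto
      have "2 * s0 * \<kappa> / \<mu> \<le> \<kappa> * (real m / real n)" using elim m by auto
      then have "2 * s0 * real n \<le> real m * \<mu>"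
        using elim kappa_pos mu_pos by (simp add: field_simps)
      then have m\<mu>: "2 * real n \<le> real m * \<mu> / s0"
        using s0_pos by (simp add: field_simps)
      have bound: "cut_sum n m k \<le> (cut_base A / sqrt k) ^ k + real (n choose k) * exp (- 2 * real n)"
        if k: "k \<in> {K..n div 2}" for k
      proof -
        have k1: "1 \<le> k" "2 * k \<le> n" using k K by auto
        have B: "0 \<le> (cut_base A / sqrt k) ^ k" by (simp add: cut_base_def)
        show ?thesis
        proof (cases "real k * s0 \<le> real n")
          case True
          then have "cut_sum n m k \<le> (cut_base A / sqrt k) ^ k"
            using cut_sum_le_local[OF k1, of m]
              choose_mult_exp_cut_rate_le[OF s0 k1(1) True m nonneg] by linarith
          then show ?thesis by (simp add: add_increasing2)
        next
          case False
          \<comment> \<open>A set containing at least a fraction \<open>1 / s0\<close> of the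
            vertices has a crude exponent of at least \<open>2 * n\<close>, which outweighs the
            \<open>2 ^ n <= exp n\<close> possible sets.\<close>
          then have "1 / s0 \<le> real k / real n" using s0_pos elim by (simp add: field_simps)
          then have "real m * \<mu> * (1 / s0) \<le> real m * \<mu> * (real k / real n)"
            using mu_pos by (intro mult_left_mono) auto
          then have "2 * real n \<le> real m * (real k / real n * \<mu>)" using m\<mu> by (simp add: mult_ac)
          then have "real (n choose k) * exp (- (real m * (real k / real n * \<mu>)))
            \<le> real (n choose k) * exp (- 2 * real n)" by (intro mult_left_mono) auto
          then show ?thesis using cut_sum_le_global[OF k1, of m] B by linarith
        qed
      qed
      have "(\<Sum>k\<in>{K..n div 2}. cut_sum n m k)
        \<le> (\<Sum>k\<in>{K..n div 2}. (cut_base A / sqrt k) ^ k + real (n choose k) * exp (- 2 * real n))"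
        by (intro sum_mono bound)
      also have "\<dots> = (\<Sum>k\<in>{K..n div 2}. (cut_base A / sqrt k) ^ k)
          + (\<Sum>k\<in>{K..n div 2}. real (n choose k)) * exp (- 2 * real n)"
        by (simp add: sum.distrib sum_distrib_right)
      also have "(\<Sum>k\<in>{K..n div 2}. real (n choose k)) \<le> (\<Sum>k\<le>n. real (n choose k))"
        by (intro sum_mono2) auto
      also have "(\<Sum>k\<le>n. real (n choose k)) = 2 ^ n"
        using choose_row_sum[of n] by (metis of_nat_numeral of_nat_power of_nat_sum)
      also have "(2 :: real) ^ n \<le> exp 1 ^ n"
        using exp_ge_add_one_self[of "1 :: real"] by (intro power_mono) auto
      also have "exp 1 ^ n * exp (- 2 * real n) = exp (- real n)"
        by (simp add: exp_of_nat_mult[symmetric] exp_add[symmetric] flip: exp_add)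
      finally show "(\<Sum>k\<in>{K..n div 2}. cut_sum n m k)
        \<le> (\<Sum>k\<in>{K..n div 2}. (cut_base A / sqrt k) ^ k) + exp (- real n)" by simp
    qed
  qed
qed

subsection \<open>The three regimes\<close>

lemma cut_base_pos: "cut_base A > 0"
  by (simp add: cut_base_def)

text \<open>Here \<open>A\<close> may be taken as large as desired, so the plain union bound works
  from \<open>k = 1\<close> on and covers isolated vertices together with all other cuts.\<close>

lemma conn_tendsto_1:
  assumes "filterlim (lam m) at_bot sequentially"
  shows "(\<lambda>n. conn n (m n)) \<longlonglongrightarrow> 1"
proof (rule LIMSEQ_I)
  fix \<epsilon> :: real assume \<epsilon>: "\<epsilon> > 0"
  define b where "b = min (1 / 2) (\<epsilon> / 8)"
  have b: "0 < b" "b \<le> 1 / 2" "b \<le> \<epsilon> / 8" using \<epsilon> by (auto simp: b_def)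
  \<comment> \<open>Chosen to give \<open>cut_base A <= b\<close>: for \<open>A >= 0\<close> the
    exponent is \<open>2 - 3 / 4 * A\<close>.\<close>
  define A where "A = max 0 (4 / 3 * (2 - ln b))"
  have "0 \<le> A" "4 / 3 * (2 - ln b) \<le> A" by (simp_all add: A_def)
  then have "2 - A + \<bar>A\<bar> / 4 \<le> ln b" by (simp add: field_simps)
  then have "cut_base A \<le> exp (ln b)" unfolding cut_base_def exp_le_cancel_iff .
  then have B: "cut_base A \<le> b" using b by simp
  have "(\<lambda>n. exp (- real n)) \<longlonglongrightarrow> 0"
    by (rule filterlim_compose[OF exp_at_bot])
       (simp add: filterlim_uminus_at_bot filterlim_real_sequentially)
  then have ev: "\<forall>\<^sub>F n in sequentially. exp (- real n) < \<epsilon> / 2"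
    using \<epsilon> by (intro order_tendstoD(2)) auto
  have "\<forall>\<^sub>F n in sequentially. lam m n \<le> - A"
    using assms by (auto simp: filterlim_at_bot)
  then have "\<forall>\<^sub>F n in sequentially. norm (conn n (m n) - 1) < \<epsilon>"
    using ev cut_sums_eventually_le[of A] eventually_ge_at_top[of 2]
  proof eventually_elim
    case (elim n)
    have "1 - conn n (m n) \<le> (\<Sum>k\<in>{1..n div 2}. cut_sum n (m n) k)"
      using elim by (intro disconnected_le_cut_sums)
    also have "\<dots> \<le> (\<Sum>k\<in>{1..n div 2}. (cut_base A / sqrt k) ^ k) + exp (- real n)"
      using elim(1,3) by (simp add: lam_def)
    also have "(\<Sum>k\<in>{1..n div 2}. (cut_base A / sqrt k) ^ k) \<le> (\<Sum>k\<in>{1..n div 2}. b ^ k)"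
    proof (intro sum_mono power_mono)
      fix k assume k: "k \<in> {1..n div 2}"
      then have "cut_base A / sqrt k \<le> cut_base A / 1"
        using cut_base_pos[of A] by (intro divide_left_mono) auto
      then show "cut_base A / sqrt k \<le> b" using B by simp
    qed (use cut_base_pos[of A] in simp)
    also have "\<dots> \<le> 2 * b ^ 1" using b by (intro sum_power_le) auto
    finally have "1 - conn n (m n) < \<epsilon>" using elim(2) b \<epsilon> by simp
    moreover have "conn n (m n) \<le> 1" by (simp add: conn_def)
    ultimately show ?case by simp
  qed
  then show "\<exists>N. \<forall>n\<ge>N. norm (conn n (m n) - 1) < \<epsilon>"
    by (simp add: eventually_sequentially)
qed

text \<open>For each fixed \<open>k\<close> the expected number of separated k-sets is bounded by a
  constant, and the extra factor from the edge inside tends to 0.\<close>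

lemma small_edge_cut_sums_tendsto_0:
  assumes "\<forall>\<^sub>F n in sequentially. b \<le> lam m n" "\<forall>\<^sub>F n in sequentially. lam m n \<le> - A"
  shows "(\<lambda>n. \<Sum>k\<in>{2..<K}. edge_cut_sum n (m n) k) \<longlonglongrightarrow> 0"
proof (rule tendsto_null_sum)
  fix k assume k: "k \<in> {2..<K}"
  obtain s0 where s0: "s0 \<ge> exp 1" "\<And>s. s \<ge> s0 \<Longrightarrow> e s * ln s \<le> \<kappa> / 4 \<and> e s \<le> \<kappa> / 4"
    using e_ln_eventually_small by blast
  let ?C = "exp 1 * (real k)\<^sup>2 * (cut_base A / sqrt k) ^ k"
  have "(\<lambda>n. ?C * (real (m n) / real n * e (real n))) \<longlonglongrightarrow> ?C * 0"
    by (intro tendsto_mult_left ratio_mult_e_tendsto_0[OF assms(1)])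
  then have lim: "(\<lambda>n. ?C * (real (m n) / real n * e (real n))) \<longlonglongrightarrow> 0" by simp
  show "(\<lambda>n. edge_cut_sum n (m n) k) \<longlonglongrightarrow> 0"
  proof (rule real_tendsto_sandwich[OF _ _ tendsto_const lim])
    show "\<forall>\<^sub>F n in sequentially. 0 \<le> edge_cut_sum n (m n) k"
      by (simp add: edge_cut_sum_def sum_nonneg)
    have "\<forall>\<^sub>F n in sequentially. real k * s0 \<le> real n"
      using filterlim_real_sequentially by (auto simp: filterlim_at_top)
    moreover have "\<forall>\<^sub>F n in sequentially. - A \<le> ln (real n)"
      using ln_nat_at_top by (auto simp: filterlim_at_top)
    ultimately show "\<forall>\<^sub>F n in sequentially. edge_cut_sum n (m n) k \<le> ?C * (real (m n) / real n * e (real n))"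
      using assms(2) eventually_ge_at_top[of "2 * k"]
    proof eventually_elim
      case (elim n)
      have k1: "1 \<le> k" using k by simp
      have n: "real n > 0" using k1 elim by simp
      have "edge_cut_sum n (m n) k \<le> exp 1 * (real k)\<^sup>2 * (real (m n) / real n * e n)
          * (real (n choose k) * exp (- (real (m n) * cut_rate n k)))"
        using k1 elim by (intro edge_cut_sum_le)
      also have "\<dots> \<le> exp 1 * (real k)\<^sup>2 * (real (m n) / real n * e n) * (cut_base A / sqrt k) ^ k"
      proof (rule mult_left_mono)
        show "real (n choose k) * exp (- (real (m n) * cut_rate n k)) \<le> (cut_base A / sqrt k) ^ k"
          using elim by (intro choose_mult_exp_cut_rate_le[OF s0 k1]) (auto simp: lam_def)
      qed (use e_nonneg[OF n] in simp)
      finally show ?case by (simp add: mult_ac)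
    qed
  qed
qed

lemma conn_asymptotic_no_isolated:
  assumes "\<forall>\<^sub>F n in sequentially. b \<le> lam m n" "\<forall>\<^sub>F n in sequentially. lam m n \<le> - A"
  shows "(\<lambda>n. no_isolated n (m n) - conn n (m n)) \<longlonglongrightarrow> 0"
proof (rule LIMSEQ_I)
  fix \<epsilon> :: real assume \<epsilon>: "\<epsilon> > 0"
  have "(\<lambda>K. 2 * (1 / 2) ^ K :: real) \<longlonglongrightarrow> 2 * 0"
    by (intro tendsto_mult_left LIMSEQ_realpow_zero) auto
  then have "\<forall>\<^sub>F K in sequentially. 2 * (1 / 2) ^ K < \<epsilon> / 3"
    by (rule order_tendstoD(2)) (use \<epsilon> in simp)
  \<comment> \<open>This makes \<open>cut_base A / sqrt k\<close> at most 1/2 for all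
    \<open>k >= K\<close>, so the large cuts are dominated by a geometric tail that does not depend
    on \<open>n\<close>.\<close>
  moreover have "\<forall>\<^sub>F K in sequentially. (2 * cut_base A)\<^sup>2 \<le> real K"
    using filterlim_real_sequentially by (auto simp: filterlim_at_top)
  ultimately have "\<forall>\<^sub>F K in sequentially. 2 * (1 / 2) ^ K < \<epsilon> / 3 \<and> (2 * cut_base A)\<^sup>2 \<le> real K \<and> K \<ge> 2"
    using eventually_ge_at_top[of 2] by eventually_elim simp
  then obtain K where K: "2 * (1 / 2) ^ K < \<epsilon> / 3" "(2 * cut_base A)\<^sup>2 \<le> real K" "K \<ge> 2"
    unfolding eventually_sequentially by blast
  have "(\<lambda>n. exp (- real n)) \<longlonglongrightarrow> 0"
    by (rule filterlim_compose[OF exp_at_bot])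
       (simp add: filterlim_uminus_at_bot filterlim_real_sequentially)
  then have ev1: "\<forall>\<^sub>F n in sequentially. exp (- real n) < \<epsilon> / 3"
    using \<epsilon> by (intro order_tendstoD(2)) auto
  have ev2: "\<forall>\<^sub>F n in sequentially. (\<Sum>k\<in>{2..<K}. edge_cut_sum n (m n) k) < \<epsilon> / 3"
    using small_edge_cut_sums_tendsto_0[OF assms] \<epsilon> by (intro order_tendstoD(2)) auto
  have "\<forall>\<^sub>F n in sequentially. norm (no_isolated n (m n) - conn n (m n) - 0) < \<epsilon>"
    using assms(2) ev1 ev2 cut_sums_eventually_le[of A] eventually_ge_at_top[of "2 * K"]
  proof eventually_elim
    case (elim n)
    have n: "n \<ge> 2" using elim K by simp
    have "no_isolated n (m n) - conn n (m n) \<le> (\<Sum>k\<in>{2..n div 2}. edge_cut_sum n (m n) k)"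
      using n by (rule no_isolated_minus_conn_le)
    also have "{2..n div 2} = {2..<K} \<union> {K..n div 2}" using K elim by auto
    also have "(\<Sum>k\<in>{2..<K} \<union> {K..n div 2}. edge_cut_sum n (m n) k)
      = (\<Sum>k\<in>{2..<K}. edge_cut_sum n (m n) k) + (\<Sum>k\<in>{K..n div 2}. edge_cut_sum n (m n) k)"
      by (intro sum.union_disjoint) auto
    also have "(\<Sum>k\<in>{K..n div 2}. edge_cut_sum n (m n) k) \<le> (\<Sum>k\<in>{K..n div 2}. cut_sum n (m n) k)"
      by (intro sum_mono edge_cut_sum_le_cut_sum)
    also have "\<dots> \<le> (\<Sum>k\<in>{K..n div 2}. (cut_base A / sqrt k) ^ k) + exp (- real n)"
      using elim(1,4) K by (simp add: lam_def)
    also have "(\<Sum>k\<in>{K..n div 2}. (cut_base A / sqrt k) ^ k) \<le> (\<Sum>k\<in>{K..n div 2}. (1 / 2) ^ k)"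
    proof (intro sum_mono power_mono)
      fix k assume k: "k \<in> {K..n div 2}"
      then have "(2 * cut_base A)\<^sup>2 \<le> real k" using K(2) by simp
      then have "2 * cut_base A \<le> sqrt k" by (rule real_le_rsqrt)
      then show "cut_base A / sqrt k \<le> 1 / 2"
        using k K by (simp add: divide_simps mult.commute)
    qed (use cut_base_pos[of A] in simp)
    also have "\<dots> \<le> 2 * (1 / 2) ^ K" by (intro sum_power_le) auto
    finally have "no_isolated n (m n) - conn n (m n) < \<epsilon>" using elim(2,3) K(1) by simp
    then show ?case using conn_le_no_isolated[OF n, of "m n"] by simp
  qed
  then show "\<exists>N. \<forall>n\<ge>N. norm (no_isolated n (m n) - conn n (m n) - 0) < \<epsilon>"
    by (simp add: eventually_sequentially)
qed

lemma conn_tendsto_critical: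
  assumes "lam m \<longlonglongrightarrow> c"
  shows "(\<lambda>n. conn n (m n)) \<longlonglongrightarrow> exp (- exp c)"
proof -
  have "\<forall>\<^sub>F n in sequentially. c - 1 \<le> lam m n"
    using order_tendstoD(1)[OF assms, of "c - 1"] by (auto elim: eventually_mono)
  \<comment> \<open>Written in the form \<open>- A\<close> with
    \<open>A = - (c + 1)\<close>.\<close>
  moreover have "\<forall>\<^sub>F n in sequentially. lam m n \<le> - (- (c + 1))"
    using order_tendstoD(2)[OF assms, of "c + 1"] by (auto elim: eventually_mono)
  ultimately have "(\<lambda>n. no_isolated n (m n) - conn n (m n)) \<longlonglongrightarrow> 0"
    by (rule conn_asymptotic_no_isolated)
  then have "(\<lambda>n. no_isolated n (m n) - (no_isolated n (m n) - conn n (m n))) \<longlonglongrightarrow> exp (- exp c) - 0"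
    by (intro tendsto_diff no_isolated_tendsto[OF assms])
  then show ?thesis by simp
qed

lemma conn_tendsto_0:
  assumes "filterlim (lam m) at_top sequentially"
  shows "(\<lambda>n. conn n (m n)) \<longlonglongrightarrow> 0"
proof (rule real_tendsto_sandwich[OF _ _ tendsto_const no_isolated_tendsto_0[OF assms]])
  show "\<forall>\<^sub>F n in sequentially. conn n (m n) \<le> no_isolated n (m n)"
    using eventually_ge_at_top[of 2] by eventually_elim (rule conn_le_no_isolated)
qed (simp add: conn_def)

end

section \<open>Transfer of the asymptotics to the random graph\<close>

context log_moment_communities
begin

sublocale law: sparse_edge_law mixed_edges_pmf mean_W mean_Q trunc_W
proof
  show "measure_pmf.prob (mixed_edges_pmf n) {E. \<not> isolated E v} \<le> mean_W / n" if "v \<in> {1..n}" for n v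
    using that by (intro prob_mixed_not_isolated) auto
qed (fact mean_W_pos mean_Q_pos trunc_W_nonneg trunc_W_mult_ln_tendsto_0 set_mixed_edges_pmf
    prob_mixed_not_isolated_pair prob_mixed_separated)+

lemma measure_random_graph_connected:
  "measure (random_graph M n m (\<lambda>i \<omega>. min (X i \<omega>) n) Q) {G. connected_graph G} = law.conn n m"
  unfolding measure_random_graph_eq law.conn_def law.G_def union_pmf_def measure_map_pmf
  by (simp add: vimage_def)

end

theorem theorem1:
  fixes M :: "'a measure" and X :: "nat \<Rightarrow> 'a \<Rightarrow> nat" and Q :: "nat \<Rightarrow> 'a \<Rightarrow> real"
    and m :: "nat \<Rightarrow> nat" and c \<kappa> :: real and lam :: "nat \<Rightarrow> real" and P :: "nat \<Rightarrow> real"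
  assumes M: "prob_space M"
    and m_pos: "\<And>n. n \<ge> 1 \<Longrightarrow> m n \<ge> 1"
    and m_lim: "filterlim m at_top sequentially"
    and Q_range: "\<And>i \<omega>. \<omega> \<in> space M \<Longrightarrow> Q i \<omega> \<in> {0..1}"
    \<comment> \<open>the pair with index \<open>0\<close> is the generic pair \<open>(X, Q)\<close>\<close>
    and indep: "prob_space.indep_vars M (\<lambda>_. count_space UNIV \<Otimes>\<^sub>M borel)
                  (\<lambda>i \<omega>. (X i \<omega>, Q i \<omega>)) UNIV"
    and ident: "\<And>i. distr M (count_space UNIV \<Otimes>\<^sub>M borel) (\<lambda>\<omega>. (X i \<omega>, Q i \<omega>)) =
                     distr M (count_space UNIV \<Otimes>\<^sub>M borel) (\<lambda>\<omega>. (X 0 \<omega>, Q 0 \<omega>))"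
    and moment: "integrable M (\<lambda>\<omega>. real (X 0 \<omega>) * h (X 0 \<omega>) (Q 0 \<omega>) * ln (real (X 0 \<omega>) + 1))"
    and nondegenerate: "(\<integral>\<omega>. Q 0 \<omega> * indicator {\<omega>. X 0 \<omega> \<ge> 2} \<omega> \<partial>M) > 0"
  defines "\<kappa> \<equiv> (\<integral>\<omega>. real (X 0 \<omega>) * h (X 0 \<omega>) (Q 0 \<omega>) \<partial>M)"
    and "lam \<equiv> \<lambda>n. ln (real n) - \<kappa> * (real (m n) / real n)"
    and "P \<equiv> \<lambda>n. measure (random_graph M n (m n) (\<lambda>i \<omega>. min (X i \<omega>) n) Q)
                   {G. connected_graph G}"
  shows "(filterlim lam at_bot sequentially \<longrightarrow> P \<longlonglongrightarrow> 1) \<and>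
         (lam \<longlonglongrightarrow> c \<longrightarrow> P \<longlonglongrightarrow> exp (- exp c)) \<and>
         (filterlim lam at_top sequentially \<longrightarrow> P \<longlonglongrightarrow> 0)"
proof -
  interpret prob_space M by (rule M)
  interpret log_moment_communities M X Q
    by unfold_locales (fact Q_range indep ident moment nondegenerate)+
  have kappa: "\<kappa> = mean_W"
    unfolding \<kappa>_def mean_W_def
    by (rule Bochner_Integration.integral_cong) (simp_all add: W_def)
  have lam: "lam = law.lam m"
    by (simp add: lam_def law.lam_def kappa fun_eq_iff)
  have P: "P = (\<lambda>n. law.conn n (m n))"
    by (simp add: P_def measure_random_graph_connected)
  show ?thesis
    unfolding lam P
    using law.conn_tendsto_1 law.conn_tendsto_critical law.conn_tendsto_0 by blast
qed

end
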